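(* Let $\tau$ be the quotient topology on $2^{\mathbb{P}}\sqcup\mathcal{U}$ induced by the surjection $\chi:\mathcal{A}\to2^{\mathbb{P}}\sqcup\mathcal{U}$. Then for a set $B\subseteq2^{\mathbb{P}}$, the $\tau$-closure of $B$ is the power-cofinite closure of $B$ if $B$ is not dense in $2^{\mathbb{P}}$ for the power-cofinite topology, and is all of $2^{\mathbb{P}}\sqcup\mathcal{U}$ if $B$ is power-cofinite dense in $2^{\mathbb{P}}$. For a set $C\subseteq\mathcal{U}$, the $\tau$-closure of $C$ is the closure of $C$ in the (idelic = product) topology of $\mathcal{U}$ if $\{c_\infty: c\in C\}$ is bounded away from $0$, and is all of $2^{\mathbb{P}}\sqcup\mathcal{U}$ if $0\in\overline{\{c_\infty: c\in C\}}$.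
   Context: $\mathcal{P}$ is the set of primes and $\mathbb{P}=\mathcal{P}\cup\{\infty\}$. $\mathcal{A}=\mathcal{A}_f\times\mathbb{R}$ is the ring of adeles of $\mathbb{Q}$ ($\mathcal{A}_f$ the restricted product of the $\mathbb{Q}_p$ relative to the $\mathbb{Z}_p$) with the product topology; $a=((a_p)_{p\in\mathcal{P}},a_\infty)$; $a$ is invertible iff all $a_p\neq0$, $a_\infty\ne0$ and $a_p\in\mathbb{Z}_p^*$ for almost all $p$. $\mathcal{U}=\prod_{p\in\mathcal{P}}\mathbb{Z}_p^*\times\mathbb{R}^*_+$ with the product topology, and $c_\infty$ denotes the $\mathbb{R}^*_+$-component of $c\in\mathcal{U}$. The map $\chi:\mathcal{A}\to2^{\mathbb{P}}\sqcup\mathcal{U}$ is $\chi(a)=a\operatorname{sign}(a_\infty)\prod_{p\in\mathcal{P}}p^{-v_p(a_p)}\in\mathcal{U}$ if $a$ is invertible and $\chi(a)=\{p\in\mathbb{P}:a_p=0\}$ otherwise ($v_p$ the $p$-adic valuation); it is surjective and identifies points with the same $\mathbb{Q}^*$-orbit closure. The power-cofinite topology on $2^{\mathbb{P}}$ has basic open sets $\{T\subseteq\mathbb{P}: T\cap G=\emptyset\}$ for finite $G\subseteq\mathbb{P}$. *)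

theory Defs
  imports "HOL-Analysis.Analysis" "HOL-Computational_Algebra.Primes"
begin

definition primes_set :: "nat set" where
  "primes_set = {p. prime p}"

text \<open>The set of places: a prime p is represented by Some p, the infinite place by None.\<close>
definition places :: "nat option set" where
  "places = Some ` primes_set \<union> {None}"

text \<open>An element x of Q_p is represented by its digit expansion: x = sum over k of (x k) * p^k,
  with digits in {0..p-1}, and only finitely many nonzero digits at negative positions.\<close>
type_synonym padic = "int \<Rightarrow> nat"

definition Qp :: "nat \<Rightarrow> padic set" where
  "Qp p = {x. (\<forall>k. x k < p) \<and> (\<exists>N. \<forall>k<N. x k = 0)}"

definition Zp :: "nat \<Rightarrow> padic set" where
  "Zp p = {x \<in> Qp p. \<forall>k<0. x k = 0}"

definition Zp_units :: "nat \<Rightarrow> padic set" where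
  "Zp_units p = {x \<in> Zp p. x 0 \<noteq> 0}"

definition padic_zero :: padic where
  "padic_zero = (\<lambda>_. 0)"

definition padic_val :: "padic \<Rightarrow> int" where
  "padic_val x = (LEAST k. x k \<noteq> 0)"

text \<open>p-adic topology on Q_p: generated by the balls x + p^N Z_p
  (= elements whose digits agree with those of x below position N).\<close>
definition Qp_top :: "nat \<Rightarrow> padic topology" where
  "Qp_top p = topology_generated_by
     {{y \<in> Qp p. \<forall>k<N. y k = x k} | x N. x \<in> Qp p}"

definition padic_trunc :: "nat \<Rightarrow> padic \<Rightarrow> int \<Rightarrow> rat" where
  "padic_trunc p x m = (\<Sum>k\<in>{k. k < m \<and> x k \<noteq> 0}. rat_of_nat (x k) * rat_of_nat p powi k)"

definition in_pZ :: "nat \<Rightarrow> int \<Rightarrow> rat \<Rightarrow> bool" where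
  "in_pZ p n q \<longleftrightarrow> (\<exists>a b. b \<noteq> 0 \<and> \<not> int p dvd b \<and>
      q = rat_of_int a * rat_of_nat p powi n / rat_of_int b)"

text \<open>Product r * x of a rational r and a p-adic number x: the unique y in Q_p such that
  the truncations of y minus r times the truncations of x tend to 0 p-adically.\<close>
definition padic_scale :: "nat \<Rightarrow> rat \<Rightarrow> padic \<Rightarrow> padic" where
  "padic_scale p r x = (THE y. y \<in> Qp p \<and>
     (\<forall>n. \<forall>\<^sub>F m in sequentially. in_pZ p n (padic_trunc p y (int m) - r * padic_trunc p x (int m))))"

type_synonym adele = "(nat \<Rightarrow> padic) \<times> real"

definition Af :: "(nat \<Rightarrow> padic) set" where
  "Af = {a \<in> (\<Pi>\<^sub>E p\<in>primes_set. Qp p). finite {p \<in> primes_set. a p \<notin> Zp p}}"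

definition adeles :: "adele set" where
  "adeles = Af \<times> UNIV"

definition Af_top :: "(nat \<Rightarrow> padic) topology" where
  "Af_top = topology_generated_by
     {{a \<in> Af. (\<forall>p\<in>S. a p \<in> U p) \<and> (\<forall>p\<in>primes_set - S. a p \<in> Zp p)} | S U.
        finite S \<and> S \<subseteq> primes_set \<and> (\<forall>p\<in>S. openin (Qp_top p) (U p))}"

definition adele_top :: "adele topology" where
  "adele_top = prod_topology Af_top euclideanreal"

definition adele_invertible :: "adele \<Rightarrow> bool" where
  "adele_invertible a \<longleftrightarrow> (\<forall>p\<in>primes_set. fst a p \<noteq> padic_zero) \<and> snd a \<noteq> 0 \<and>
      finite {p \<in> primes_set. fst a p \<notin> Zp_units p}"

definition chi_factor :: "adele \<Rightarrow> rat" where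
  "chi_factor a = (if snd a > 0 then 1 else -1) *
     (\<Prod>p\<in>{p \<in> primes_set. padic_val (fst a p) \<noteq> 0}. rat_of_nat p powi (- padic_val (fst a p)))"

definition units_U :: "adele set" where
  "units_U = (\<Pi>\<^sub>E p\<in>primes_set. Zp_units p) \<times> {0<..}"

definition units_top :: "adele topology" where
  "units_top = prod_topology
     (product_topology (\<lambda>p. subtopology (Qp_top p) (Zp_units p)) primes_set)
     (subtopology euclideanreal {0<..})"

definition chi :: "adele \<Rightarrow> nat option set + adele" where
  "chi a = (if adele_invertible a
     then Inr ((\<lambda>p\<in>primes_set. padic_scale p (chi_factor a) (fst a p)),
               real_of_rat (chi_factor a) * snd a)
     else Inl {v \<in> places. case v of None \<Rightarrow> snd a = 0 | Some p \<Rightarrow> fst a p = padic_zero})"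

definition chi_target :: "(nat option set + adele) set" where
  "chi_target = Inl ` Pow places \<union> Inr ` units_U"

definition pc_top :: "nat option set topology" where
  "pc_top = topology_generated_by
     {{T \<in> Pow places. T \<inter> G = {}} | G. finite G \<and> G \<subseteq> places}"

end

theory Submission
  imports Defs "HOL-Number_Theory.Cong"
begin

text \<open>Whether a set is closed in the quotient is tested on its preimage in the adeles.

  The zero set of an adele depends continuously on it for the power-cofinite topology, and near any
  adele there are non-invertible adeles with any prescribed zero set that avoids finitely many
  places at which the given adele does not vanish. This handles subsets of the power set; in
  particular the image of an adele that is non-invertible but vanishes nowhere is a generic point.

  The preimage of a set D of units is the union of the dilates of D by nonzero rationals. If the
  real components of D are bounded away from 0, this union is locally finite, because the
  rationals that occur near a given adele have bounded size and bounded denominator. If the real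
  components of C accumulate at 0, the Chinese remainder theorem yields integral multiples of
  elements of C arbitrarily close to the adele with real component 1 and component p at each prime
  p, whose image is the generic point.\<close>

section \<open>Divisibility of rationals by powers of a prime\<close>

text \<open>Since p-adic numbers are digit sequences and a rational multiple is given only by a
  description through truncations, the argument works without a ring structure on digit sequences.
  Everything is reduced to congruences between rationals: \<open>digits_eq_iff\<close> turns
  agreement of digits below n into divisibility of a difference by p^n, and
  \<open>is_scale_trunc\<close> turns the limit that defines a multiple into one such congruence.

  The empty zero set is the delicate point. Invertible adeles vanish nowhere either, yet chi sends
  them to units, so membership of the image in a subset K of the power set can be read off the zero
  set only when {} is not in K. Failure of density provides exactly this, because every nonempty
  power-cofinite open set contains {}. Conversely, a closure that contains \<open>Inl {}\<close> is
  everything, and both degenerate cases reduce to that.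

  For units the obstacle is that positivity of the real component is not a closed condition among
  adeles: without a lower bound, even a closed set of units may fail to be closed in the
  adeles.\<close>

context
  fixes p :: nat
  assumes p: "prime p"
begin

lemma p_gt_0: "rat_of_nat p \<noteq> 0"
  using p by (simp add: prime_gt_0_nat)

lemma not_p_dvd_1: "\<not> int p dvd 1"
  using p by (metis not_prime_unit prime_int_nat_transfer of_nat_1 int_dvd_int_iff)

lemma in_pZ_powi: "in_pZ p n (rat_of_nat p powi n)"
  unfolding in_pZ_def by (rule exI[of _ 1], rule exI[of _ 1]) (use not_p_dvd_1 in simp)

lemma in_pZ_of_int: "in_pZ p 0 (rat_of_int a)"
  unfolding in_pZ_def by (rule exI[of _ a], rule exI[of _ 1]) (use not_p_dvd_1 in simp)

lemma in_pZ_0: "in_pZ p n 0"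
  unfolding in_pZ_def by (rule exI[of _ 0], rule exI[of _ 1]) (use not_p_dvd_1 in simp)

lemma in_pZ_add:
  assumes "in_pZ p n r" "in_pZ p n s" shows "in_pZ p n (r + s)"
proof -
  obtain a b c d where "b \<noteq> 0" "\<not> int p dvd b" "r = rat_of_int a * rat_of_nat p powi n / rat_of_int b"
    "d \<noteq> 0" "\<not> int p dvd d" "s = rat_of_int c * rat_of_nat p powi n / rat_of_int d"
    using assms unfolding in_pZ_def by blast
  moreover from this have "\<not> int p dvd b * d"
    using p by (simp add: prime_dvd_mult_iff)
  ultimately show ?thesis
    unfolding in_pZ_def by (intro exI[of _ "a * d + c * b"] exI[of _ "b * d"]) (simp add: field_simps)
qed

lemma in_pZ_mult:
  assumes "in_pZ p n r" "in_pZ p m s" shows "in_pZ p (n + m) (r * s)"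
proof -
  obtain a b c d where "b \<noteq> 0" "\<not> int p dvd b" "r = rat_of_int a * rat_of_nat p powi n / rat_of_int b"
    "d \<noteq> 0" "\<not> int p dvd d" "s = rat_of_int c * rat_of_nat p powi m / rat_of_int d"
    using assms unfolding in_pZ_def by blast
  moreover from this have "\<not> int p dvd b * d"
    using p by (simp add: prime_dvd_mult_iff)
  ultimately show ?thesis
    unfolding in_pZ_def using p_gt_0
    by (intro exI[of _ "a * c"] exI[of _ "b * d"]) (simp add: power_int_add)
qed

lemma in_pZ_uminus: "in_pZ p n r \<Longrightarrow> in_pZ p n (- r)"
  using in_pZ_mult[OF in_pZ_of_int[of "-1"], of n r] by simp

lemma in_pZ_diff: "in_pZ p n r \<Longrightarrow> in_pZ p n s \<Longrightarrow> in_pZ p n (r - s)"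
  using in_pZ_add[of n r "- s"] in_pZ_uminus[of n s] by simp

lemma in_pZ_mono:
  assumes "in_pZ p m r" "n \<le> m" shows "in_pZ p n r"
proof -
  \<comment> \<open>The factor p^(n - m) moves the exponent from m to n; the integer p^(m - n) then
    restores r and leaves the exponent alone.\<close>
  have "in_pZ p n (r / rat_of_nat p powi m * rat_of_nat p powi n)"
    using in_pZ_mult[OF assms(1) in_pZ_powi[of "n - m"]] by (simp only: power_int_diff[OF disjI1[OF p_gt_0]]) simp
  from in_pZ_mult[OF this in_pZ_of_int[of "int p ^ nat (m - n)"]]
  have "in_pZ p n (r / rat_of_nat p powi m * rat_of_nat p powi n * of_int (int p ^ nat (m - n)))"
    by simp
  moreover have "rat_of_nat p powi m = rat_of_nat p powi n * of_int (int p ^ nat (m - n))"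
    using p_gt_0 assms(2) by (simp flip: power_int_of_nat add: power_int_diff)
  ultimately show ?thesis using p_gt_0 by simp
qed

lemma in_pZ_Suc_imp_dvd:
  assumes "in_pZ p (k + 1) (rat_of_int c * rat_of_nat p powi k)" shows "int p dvd c"
proof -
  obtain a b where ab: "b \<noteq> 0" "\<not> int p dvd b"
    "rat_of_int c * rat_of_nat p powi k = rat_of_int a * rat_of_nat p powi (k + 1) / rat_of_int b"
    using assms unfolding in_pZ_def by blast
  then have "rat_of_int (c * b) = rat_of_int (a * int p)"
    using p_gt_0 by (simp add: power_int_add field_simps)
  then have "c * b = a * int p" by (simp only: of_int_eq_iff)
  then have "int p dvd c * b" by simp
  then show ?thesis using ab p by (simp add: prime_dvd_mult_iff)
qed

section \<open>Digit expansions and their truncations\<close>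

lemma finite_digits: "x \<in> Qp p \<Longrightarrow> finite {k. k < m \<and> x k \<noteq> 0}"
proof -
  assume "x \<in> Qp p"
  then obtain N where "\<forall>k<N. x k = 0" by (auto simp: Qp_def)
  then have "{k. k < m \<and> x k \<noteq> 0} \<subseteq> {N..<m}" by (force simp: not_less[symmetric])
  then show ?thesis by (rule finite_subset) simp
qed

lemma padic_trunc_cong: "(\<And>k. k < m \<Longrightarrow> x k = y k) \<Longrightarrow> padic_trunc p x m = padic_trunc p y m"
  unfolding padic_trunc_def by (rule sum.cong) auto

lemma padic_trunc_eq_0: "(\<And>k. k < m \<Longrightarrow> x k = 0) \<Longrightarrow> padic_trunc p x m = 0"
  unfolding padic_trunc_def by (rule sum.neutral) auto

lemma padic_trunc_step:
  assumes "x \<in> Qp p"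
  shows "padic_trunc p x (m + 1) = padic_trunc p x m + rat_of_nat (x m) * rat_of_nat p powi m"
proof (cases "x m = 0")
  case True
  then have "{k. k < m + 1 \<and> x k \<noteq> 0} = {k. k < m \<and> x k \<noteq> 0}"
    unfolding zless_add1_eq by blast
  then show ?thesis using True by (simp add: padic_trunc_def)
next
  case False
  then have "{k. k < m + 1 \<and> x k \<noteq> 0} = insert m {k. k < m \<and> x k \<noteq> 0}"
    unfolding zless_add1_eq by blast
  then show ?thesis using finite_digits[OF assms, of m] by (simp add: padic_trunc_def)
qed

lemma in_pZ_trunc_diff:
  assumes x: "x \<in> Qp p" and "n \<le> m"
  shows "in_pZ p n (padic_trunc p x m - padic_trunc p x n)"
  using assms(2)
proof (induction m rule: int_ge_induct)
  case base
  show ?case by (simp add: in_pZ_0)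
next
  case (step m)
  have "in_pZ p n (rat_of_int (int (x m)) * rat_of_nat p powi m)"
    using in_pZ_mult[OF in_pZ_of_int[of "int (x m)"] in_pZ_mono[OF in_pZ_powi step(1)]] by simp
  from in_pZ_add[OF this step(2)] show ?case
    unfolding padic_trunc_step[OF x] by (simp add: algebra_simps)
qed

text \<open>At the lowest position k where the digits differ, the truncations differ by a digit
  difference times p^k. Digits lie in 0..p-1, so that difference is prime to p, while higher
  positions contribute multiples of p^(k+1).\<close>

lemma digits_eq_iff:
  assumes x: "x \<in> Qp p" and y: "y \<in> Qp p"
  shows "in_pZ p n (padic_trunc p x n - padic_trunc p y n) \<longleftrightarrow> (\<forall>k<n. x k = y k)"
proof
  assume "\<forall>k<n. x k = y k"
  then have "padic_trunc p x n = padic_trunc p y n" by (intro padic_trunc_cong) auto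
  then show "in_pZ p n (padic_trunc p x n - padic_trunc p y n)" by (simp add: in_pZ_0)
next
  assume *: "in_pZ p n (padic_trunc p x n - padic_trunc p y n)"
  show "\<forall>k<n. x k = y k"
  proof (rule ccontr)
    assume "\<not> (\<forall>k<n. x k = y k)"
    then have ne: "{k. k < n \<and> x k \<noteq> y k} \<noteq> {}" by auto
    have "{k. k < n \<and> x k \<noteq> y k} \<subseteq> {k. k < n \<and> x k \<noteq> 0} \<union> {k. k < n \<and> y k \<noteq> 0}" by auto
    then have fin: "finite {k. k < n \<and> x k \<noteq> y k}"
      using finite_digits[OF x] finite_digits[OF y] by (meson finite_UnI finite_subset)
    define k where "k = Min {k. k < n \<and> x k \<noteq> y k}"
    have k: "k < n" "x k \<noteq> y k" using Min_in[OF fin ne] by (auto simp: k_def)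
    have below: "x j = y j" if "j < k" for j
      using Min_le[OF fin, of j] that k(1) unfolding k_def by fastforce
    have eq: "padic_trunc p x k = padic_trunc p y k" by (intro padic_trunc_cong below)
    have "in_pZ p (k + 1) (padic_trunc p x n - padic_trunc p y n
        - (padic_trunc p x n - padic_trunc p x (k + 1)) + (padic_trunc p y n - padic_trunc p y (k + 1)))"
      using k(1) by (intro in_pZ_add in_pZ_diff in_pZ_trunc_diff x y in_pZ_mono[OF *]) auto
    then have "in_pZ p (k + 1) (rat_of_int (int (x k) - int (y k)) * rat_of_nat p powi k)"
      using padic_trunc_step[OF x, of k] padic_trunc_step[OF y, of k] eq by (simp add: algebra_simps)
    then have "int p dvd int (x k) - int (y k)" by (rule in_pZ_Suc_imp_dvd)
    moreover have "x k < p" "y k < p" using x y by (auto simp: Qp_def)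
    ultimately show False using k(2)
      using dvd_imp_le_int[of "int (x k) - int (y k)" "int p"] by auto
  qed
qed

lemma padic_zero_Qp: "padic_zero \<in> Qp p"
  using p by (simp add: Qp_def padic_zero_def prime_gt_0_nat)

lemma trunc_padic_zero: "padic_trunc p padic_zero m = 0"
  by (rule padic_trunc_eq_0) (simp add: padic_zero_def)

text \<open>Digits are produced one at a time: if the remaining error is p^n a/b with b prime to p,
  the next digit is the residue of a/b modulo p.\<close>

lemma ex_digits_approx:
  assumes "in_pZ p v q"
  shows "\<exists>y\<in>Qp p. in_pZ p (v + int d) (padic_trunc p y (v + int d) - q)"
proof (induction d)
  case 0
  have "in_pZ p v (- q)" using assms by (rule in_pZ_uminus)
  then show ?case by (intro bexI[OF _ padic_zero_Qp]) (simp add: trunc_padic_zero)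
next
  case (Suc d)
  then obtain y where y: "y \<in> Qp p" "in_pZ p (v + int d) (padic_trunc p y (v + int d) - q)" by blast
  then have "in_pZ p (v + int d) (q - padic_trunc p y (v + int d))"
    using in_pZ_uminus by fastforce
  then obtain a b where ab: "b \<noteq> 0" "\<not> int p dvd b"
    "q - padic_trunc p y (v + int d) = rat_of_int a * rat_of_nat p powi (v + int d) / rat_of_int b"
    unfolding in_pZ_def by blast
  define n where "n = v + int d"
  have "coprime b (int p)"
    using prime_imp_coprime[of "int p" b] ab(2) p by (simp add: coprime_commute)
  then obtain u w where "u * b + w * int p = 1"
    using bezout_int[of b "int p"] by auto
  then have "b * u - 1 = int p * - w" by (simp add: algebra_simps)
  then have u: "int p dvd b * u - 1" by (metis dvd_triv_left)
  define c where "c = nat (a * u mod int p)"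
  have pp: "int p > 0" using p by (simp add: prime_gt_0_nat)
  have c: "int c = a * u mod int p" using pp by (simp add: c_def)
  have "c < p" using pp c by (metis of_nat_less_iff pos_mod_bound)
  obtain f where f: "b * u - 1 = int p * f" using u by (auto simp: dvd_def)
  have "a * u - int c = int p * (a * u div int p)" by (simp add: c minus_mod_eq_mult_div)
  then have c': "int c = a * u - int p * (a * u div int p)" by simp
  have "b * int c - a = a * (b * u - 1) - int p * (b * (a * u div int p))"
    unfolding c' by (simp add: algebra_simps)
  also have "\<dots> = int p * (a * f - b * (a * u div int p))"
    unfolding f by (simp add: algebra_simps)
  finally obtain e where e: "b * int c - a = int p * e" by blast
  \<comment> \<open>Overwriting position n is harmless, since only the digits of \<open>y\<close>
    below n are known to be correct.\<close>
  let ?y = "y(n := c)"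
  obtain N where N: "\<forall>k<N. y k = 0" using y(1) by (auto simp: Qp_def)
  have y': "?y \<in> Qp p" using y(1) \<open>c < p\<close> N by (auto simp: Qp_def intro!: exI[of _ "min N n"])
  have "padic_trunc p ?y (n + 1) = padic_trunc p y n + rat_of_nat c * rat_of_nat p powi n"
    using padic_trunc_step[OF y', of n] padic_trunc_cong[of n ?y y] by simp
  then have "padic_trunc p ?y (n + 1) - q
      = rat_of_nat c * rat_of_nat p powi n - rat_of_int a * rat_of_nat p powi n / rat_of_int b"
    using ab(3) by (simp add: n_def algebra_simps)
  also have "\<dots> = rat_of_int (b * int c - a) * rat_of_nat p powi n / rat_of_int b"
    using ab(1) by (simp add: field_simps)
  also have "\<dots> = rat_of_int e * rat_of_nat p powi (n + 1) / rat_of_int b"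
    using p_gt_0 by (simp add: e power_int_add)
  finally have "in_pZ p (n + 1) (padic_trunc p ?y (n + 1) - q)"
    using ab unfolding in_pZ_def by blast
  moreover have "n + 1 = v + int (Suc d)" by (simp add: n_def)
  ultimately show ?case using y' by metis
qed

lemma ex_digits_approx':
  assumes "in_pZ p v q"
  shows "\<exists>y\<in>Qp p. in_pZ p N (padic_trunc p y N - q)"
proof -
  define n where "n = v + int (nat (N - v))"
  have "N \<le> n" by (simp add: n_def)
  obtain y where y: "y \<in> Qp p" "in_pZ p n (padic_trunc p y n - q)"
    using ex_digits_approx[OF assms, of "nat (N - v)"] by (auto simp: n_def)
  have "in_pZ p N (padic_trunc p y n - q - (padic_trunc p y n - padic_trunc p y N))"
    by (intro in_pZ_diff in_pZ_trunc_diff y in_pZ_mono[OF y(2)] \<open>N \<le> n\<close>)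
  then show ?thesis using y(1) by auto
qed

section \<open>Scaling a p-adic number by a rational\<close>

text \<open>The predicate under the definite description in \<open>padic_scale\<close>, named so
  that existence and uniqueness can be settled first.\<close>

definition is_scale :: "rat \<Rightarrow> padic \<Rightarrow> padic \<Rightarrow> bool" where
  "is_scale r x y \<longleftrightarrow> y \<in> Qp p \<and>
     (\<forall>n. \<forall>\<^sub>F m in sequentially. in_pZ p n (padic_trunc p y (int m) - r * padic_trunc p x (int m)))"

lemma is_scale_Qp: "is_scale r x y \<Longrightarrow> y \<in> Qp p"
  by (simp add: is_scale_def)

lemma is_scaleE:
  assumes "is_scale r x y"
  obtains m where "l \<le> int m" "in_pZ p n (padic_trunc p y (int m) - r * padic_trunc p x (int m))"
proof -
  have "\<forall>\<^sub>F m in sequentially. in_pZ p n (padic_trunc p y (int m) - r * padic_trunc p x (int m))"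
    using assms by (simp add: is_scale_def)
  then obtain M where "\<And>m. m \<ge> M \<Longrightarrow> in_pZ p n (padic_trunc p y (int m) - r * padic_trunc p x (int m))"
    by (auto simp: eventually_sequentially)
  then show ?thesis using that[of "max M (nat l)"] by auto
qed

text \<open>The defining limit is attained at an explicit finite level: as p^v divides r, digits of
  x from position N - v on affect r x only from position N on.\<close>

lemma is_scale_trunc:
  assumes x: "x \<in> Qp p" and r: "in_pZ p v r" and s: "is_scale r x y"
  shows "in_pZ p N (padic_trunc p y N - r * padic_trunc p x (N - v))"
proof -
  obtain m where m: "max N (N - v) \<le> int m" "in_pZ p N (padic_trunc p y (int m) - r * padic_trunc p x (int m))"
    using is_scaleE[OF s] .
  have "in_pZ p (v + (N - v)) (r * (padic_trunc p x (int m) - padic_trunc p x (N - v)))"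
    using m(1) by (intro in_pZ_mult r in_pZ_trunc_diff x) auto
  then have "in_pZ p N (padic_trunc p y (int m) - r * padic_trunc p x (int m)
      + r * (padic_trunc p x (int m) - padic_trunc p x (N - v)) - (padic_trunc p y (int m) - padic_trunc p y N))"
    using m(1) by (intro in_pZ_add in_pZ_diff m(2) in_pZ_trunc_diff is_scale_Qp[OF s]) auto
  then show ?thesis by (simp add: algebra_simps)
qed

lemma is_scale_unique:
  assumes s: "is_scale r x y" and s': "is_scale r x y'"
  shows "y = y'"
proof
  fix k
  have ev: "\<forall>\<^sub>F m in sequentially. in_pZ p (k + 1) (padic_trunc p z (int m) - r * padic_trunc p x (int m))"
    if "is_scale r x z" for z using that by (simp add: is_scale_def)
  have "\<forall>\<^sub>F m in sequentially. k + 1 \<le> int m"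
    unfolding eventually_sequentially by (intro exI[of _ "nat (k + 1)"]) auto
  with ev[OF s] ev[OF s'] have "\<forall>\<^sub>F m in sequentially. k + 1 \<le> int m
      \<and> in_pZ p (k + 1) (padic_trunc p y (int m) - r * padic_trunc p x (int m))
      \<and> in_pZ p (k + 1) (padic_trunc p y' (int m) - r * padic_trunc p x (int m))"
    by eventually_elim auto
  then obtain m :: nat where m: "k + 1 \<le> int m"
    "in_pZ p (k + 1) (padic_trunc p y (int m) - r * padic_trunc p x (int m))"
    "in_pZ p (k + 1) (padic_trunc p y' (int m) - r * padic_trunc p x (int m))"
    by (metis (no_types, lifting) eventually_happens' sequentially_bot)
  have "in_pZ p (k + 1) ((padic_trunc p y (int m) - r * padic_trunc p x (int m))
      - (padic_trunc p y (int m) - padic_trunc p y (k + 1))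
      - ((padic_trunc p y' (int m) - r * padic_trunc p x (int m))
      - (padic_trunc p y' (int m) - padic_trunc p y' (k + 1))))"
    by (intro in_pZ_diff m in_pZ_trunc_diff is_scale_Qp[OF s] is_scale_Qp[OF s'])
  then have "in_pZ p (k + 1) (padic_trunc p y (k + 1) - padic_trunc p y' (k + 1))"
    by simp
  then show "y k = y' k"
    using digits_eq_iff[OF is_scale_Qp[OF s] is_scale_Qp[OF s']] by auto
qed

lemma padic_scale_eqI: "is_scale r x y \<Longrightarrow> padic_scale p r x = y"
  unfolding padic_scale_def by (fold is_scale_def) (blast intro: the_equality is_scale_unique)

text \<open>The multiples by r of the truncations of x are p-adically Cauchy. Their digit expansions
  to increasing precision are coherent and glue to one sequence.\<close>

lemma ex_is_scale_aux:
  assumes x: "x \<in> Qp p" and r: "in_pZ p v r"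
  shows "\<exists>y. is_scale r x y"
proof -
  obtain L where L: "\<forall>k<L. x k = 0" using x by (auto simp: Qp_def)
  \<comment> \<open>The truncation at N - v is the one that determines r x modulo p^N, whence
    \<open>s_diff\<close>.\<close>
  define s where "s N = r * padic_trunc p x (N - v)" for N
  have s_diff: "in_pZ p n (s N - s N')" if "n \<le> N" "n \<le> N'" for n N N'
  proof -
    have "in_pZ p (v + (n - v)) (r * ((padic_trunc p x (N - v) - padic_trunc p x (n - v))
        - (padic_trunc p x (N' - v) - padic_trunc p x (n - v))))"
      using that by (intro in_pZ_mult r in_pZ_diff in_pZ_trunc_diff x) auto
    then show ?thesis by (simp add: s_def algebra_simps)
  qed
  have s0: "s N = 0" if "N \<le> v + L" for N
    unfolding s_def using L that by (subst padic_trunc_eq_0) auto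
  have s_in: "in_pZ p (v + L) (s N)" for N
  proof (cases "N \<le> v + L")
    case True
    then show ?thesis by (simp add: s0 in_pZ_0)
  next
    case False
    then show ?thesis using s_diff[of "v + L" N "v + L"] s0[of "v + L"] by simp
  qed
  have "\<forall>N. \<exists>y\<in>Qp p. in_pZ p N (padic_trunc p y N - s N)"
    using ex_digits_approx'[OF s_in] by blast
  then obtain Y where Y: "\<And>N. Y N \<in> Qp p" "\<And>N. in_pZ p N (padic_trunc p (Y N) N - s N)"
    by metis
  \<comment> \<open>\<open>Y (k + 1)\<close> is the first approximation that is already final in
    digit k.\<close>
  define y where "y k = Y (k + 1) k" for k
  have Y_eq: "Y N k = y k" if "k < N" for N k
  proof -
    have "in_pZ p (k + 1) ((padic_trunc p (Y N) N - s N) - (padic_trunc p (Y N) N - padic_trunc p (Y N) (k + 1))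
        + (s N - s (k + 1)) - (padic_trunc p (Y (k + 1)) (k + 1) - s (k + 1)))"
      using that by (intro in_pZ_add in_pZ_diff in_pZ_trunc_diff Y s_diff in_pZ_mono[OF Y(2)]) auto
    then have "in_pZ p (k + 1) (padic_trunc p (Y N) (k + 1) - padic_trunc p (Y (k + 1)) (k + 1))"
      by simp
    then show ?thesis using digits_eq_iff[OF Y(1) Y(1)] by (auto simp: y_def)
  qed
  have "y k = 0" if "k < v + L" for k
  proof -
    have "in_pZ p (k + 1) (padic_trunc p (Y (k + 1)) (k + 1) - padic_trunc p padic_zero (k + 1))"
      using Y(2)[of "k + 1"] s0[of "k + 1"] that by (simp add: trunc_padic_zero)
    then show ?thesis using digits_eq_iff[OF Y(1) padic_zero_Qp] by (auto simp: y_def padic_zero_def)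
  qed
  moreover have "y k < p" for k using Y(1)[of "k + 1"] by (auto simp: y_def Qp_def)
  ultimately have y: "y \<in> Qp p" by (auto simp: Qp_def)
  have "in_pZ p n (padic_trunc p y (int m) - r * padic_trunc p x (int m))"
    if "m \<ge> nat (max n (n - v))" for m n
  proof -
    have "padic_trunc p y (int m) = padic_trunc p (Y (int m)) (int m)"
      by (rule padic_trunc_cong) (simp add: Y_eq)
    \<comment> \<open>\<open>s (int m + v)\<close> is r times the truncation of x at m; passing to
      it from \<open>s (int m)\<close> costs a multiple of p^n.\<close>
    moreover have "in_pZ p n ((padic_trunc p (Y (int m)) (int m) - s (int m)) + (s (int m) - s (int m + v)))"
      using that by (intro in_pZ_add s_diff in_pZ_mono[OF Y(2)]) auto
    ultimately show ?thesis by (simp add: s_def)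
  qed
  then have "is_scale r x y"
    unfolding is_scale_def eventually_sequentially by (intro conjI y allI) (rule exI, blast)
  then show ?thesis by blast
qed

lemma is_scale_mult:
  assumes x: "x \<in> Qp p" and s: "in_pZ p w s" and "is_scale r x y" "is_scale s y z"
  shows "is_scale (s * r) x z"
  unfolding is_scale_def
proof (intro conjI allI is_scale_Qp[OF assms(4)])
  fix n
  have "\<forall>\<^sub>F m in sequentially. in_pZ p (n - w) (padic_trunc p y (int m) - r * padic_trunc p x (int m))"
    "\<forall>\<^sub>F m in sequentially. in_pZ p n (padic_trunc p z (int m) - s * padic_trunc p y (int m))"
    using assms(3,4) by (simp_all add: is_scale_def)
  then show "\<forall>\<^sub>F m in sequentially. in_pZ p n (padic_trunc p z (int m) - s * r * padic_trunc p x (int m))"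
  proof eventually_elim
    case (elim m)
    have "in_pZ p n (s * (padic_trunc p y (int m) - r * padic_trunc p x (int m)))"
      using in_pZ_mult[OF s elim(1)] by simp
    from in_pZ_add[OF elim(2) this] show ?case by (simp add: algebra_simps)
  qed
qed

lemma is_scale_1: "x \<in> Qp p \<Longrightarrow> is_scale 1 x x"
  by (simp add: is_scale_def in_pZ_0)

lemma is_scale_zero: "is_scale r padic_zero padic_zero"
  by (simp add: is_scale_def in_pZ_0 trunc_padic_zero padic_zero_Qp)

text \<open>The p-adic valuation of r as a relation. The condition on the inverse bounds the
  valuation from above, so that products and inverses both follow from \<open>in_pZ_mult\<close> or
  by symmetry.\<close>

definition has_pval :: "int \<Rightarrow> rat \<Rightarrow> bool" where
  "has_pval w r \<longleftrightarrow> r \<noteq> 0 \<and> in_pZ p w r \<and> in_pZ p (- w) (inverse r)"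

lemma has_pval_mult: "has_pval v r \<Longrightarrow> has_pval w s \<Longrightarrow> has_pval (v + w) (r * s)"
  unfolding has_pval_def using in_pZ_mult[of v r w s] in_pZ_mult[of "-v" "inverse r" "-w" "inverse s"]
  by simp

lemma has_pval_inverse: "has_pval v r \<Longrightarrow> has_pval (- v) (inverse r)"
  by (simp add: has_pval_def)

lemma has_pval_powi: "has_pval k (rat_of_nat p powi k)"
  using in_pZ_powi[of k] in_pZ_powi[of "- k"] p_gt_0 by (simp add: has_pval_def power_int_minus)

lemma has_pval_unit:
  assumes "\<not> int p dvd a" shows "has_pval 0 (rat_of_int a)"
proof -
  have "in_pZ p 0 (inverse (rat_of_int a))"
    unfolding in_pZ_def using assms by (intro exI[of _ 1] exI[of _ a]) (auto simp: divide_inverse)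
  then show ?thesis using in_pZ_of_int assms by (auto simp: has_pval_def)
qed

lemma has_pval_of_int:
  assumes "a \<noteq> 0"
  shows "has_pval (int (multiplicity (int p) a)) (rat_of_int a)"
proof -
  have "\<not> is_unit (int p)" using not_p_dvd_1 by simp
  then obtain b where b: "a = int p ^ multiplicity (int p) a * b" "\<not> int p dvd b"
    using multiplicity_decompose'[OF assms] by metis
  have "rat_of_int a = rat_of_int (int p ^ multiplicity (int p) a * b)"
    using b(1) by (rule arg_cong)
  also have "\<dots> = rat_of_nat p powi int (multiplicity (int p) a) * rat_of_int b"
    by (simp only: of_int_mult of_int_power power_int_of_nat of_int_of_nat_eq)
  finally show ?thesis
    using has_pval_mult[OF has_pval_powi has_pval_unit[OF b(2)], of "int (multiplicity (int p) a)"] by simp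
qed

lemma ex_has_pval:
  assumes "r \<noteq> 0" shows "\<exists>v. has_pval v r"
proof -
  obtain a b where ab: "b > 0" "r = rat_of_int a / rat_of_int b"
    using quotient_of_div quotient_of_denom_pos by (metis surj_pair)
  then have "a \<noteq> 0" "b \<noteq> 0" using assms by auto
  then show ?thesis
    using has_pval_mult[OF has_pval_of_int[of a] has_pval_inverse[OF has_pval_of_int[of b]]] ab(2)
    by (auto simp: divide_inverse)
qed

lemma ex_in_pZ: "\<exists>v. in_pZ p v r"
  using ex_has_pval[of r] in_pZ_0[of 0] by (cases "r = 0") (auto simp: has_pval_def)

section \<open>Existence and composition of rational multiples\<close>

lemma is_scale_padic_scale: "x \<in> Qp p \<Longrightarrow> is_scale r x (padic_scale p r x)"
proof -
  assume x: "x \<in> Qp p"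
  obtain v where "in_pZ p v r" using ex_in_pZ by blast
  then obtain y where "is_scale r x y" using ex_is_scale_aux[OF x] by blast
  then show ?thesis using padic_scale_eqI by simp
qed

lemma padic_scale_Qp: "x \<in> Qp p \<Longrightarrow> padic_scale p r x \<in> Qp p"
  using is_scale_padic_scale is_scale_Qp by blast

lemma padic_scale_1: "x \<in> Qp p \<Longrightarrow> padic_scale p 1 x = x"
  by (rule padic_scale_eqI[OF is_scale_1])

lemma padic_scale_zero: "padic_scale p r padic_zero = padic_zero"
  by (rule padic_scale_eqI[OF is_scale_zero])

lemma padic_scale_scale: "x \<in> Qp p \<Longrightarrow> padic_scale p s (padic_scale p r x) = padic_scale p (s * r) x"
proof -
  assume x: "x \<in> Qp p"
  obtain v where "in_pZ p v s" using ex_in_pZ by blast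
  then have "is_scale (s * r) x (padic_scale p s (padic_scale p r x))"
    using is_scale_mult[OF x] is_scale_padic_scale[OF x] is_scale_padic_scale[OF padic_scale_Qp[OF x]] by blast
  then show ?thesis by (simp add: padic_scale_eqI)
qed

text \<open>Both multiples are congruent modulo p^N to r times the same truncation. This gives
  continuity of scaling and, by comparison with zero, \<open>padic_scale_zeros\<close>.\<close>

lemma padic_scale_cong:
  assumes x: "x \<in> Qp p" and x': "x' \<in> Qp p" and r: "in_pZ p v r"
    and eq: "\<And>k. k < N - v \<Longrightarrow> x k = x' k" and "k < N"
  shows "padic_scale p r x k = padic_scale p r x' k"
proof -
  have "padic_trunc p x (N - v) = padic_trunc p x' (N - v)"
    by (rule padic_trunc_cong) (rule eq)
  then have "in_pZ p N (padic_trunc p (padic_scale p r x) N - padic_trunc p (padic_scale p r x') N)"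
    using in_pZ_diff[OF is_scale_trunc[OF x r is_scale_padic_scale[OF x]]
        is_scale_trunc[OF x' r is_scale_padic_scale[OF x']], of N] by simp
  then show ?thesis
    using digits_eq_iff[OF padic_scale_Qp[OF x] padic_scale_Qp[OF x']] \<open>k < N\<close> by blast
qed

text \<open>A relational valuation: \<open>padic_val\<close> is a \<open>LEAST\<close> over all
  integers and is meaningful only once a lowest nonzero digit is known to exist.\<close>

definition has_val :: "padic \<Rightarrow> int \<Rightarrow> bool" where
  "has_val x v \<longleftrightarrow> x \<in> Qp p \<and> x v \<noteq> 0 \<and> (\<forall>k<v. x k = 0)"

lemma padic_scale_zeros:
  assumes x: "x \<in> Qp p" and r: "in_pZ p w r" and "\<And>k. k < v \<Longrightarrow> x k = 0" and "k < v + w"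
  shows "padic_scale p r x k = 0"
  using padic_scale_cong[OF x padic_zero_Qp r, of "v + w" k] assms
  by (simp add: padic_scale_zero) (simp add: padic_zero_def)

text \<open>Leading zeros are shifted by w. If the new leading digit vanished as well, scaling back
  by the inverse of r would make digit v of x vanish.\<close>

lemma has_val_scale:
  assumes x: "has_val x v" and r: "has_pval w r"
  shows "has_val (padic_scale p r x) (v + w)"
proof -
  have xQ: "x \<in> Qp p" and r': "in_pZ p w r" "in_pZ p (- w) (inverse r)" "r \<noteq> 0"
    using x r by (auto simp: has_val_def has_pval_def)
  have 1: "padic_scale p r x k = 0" if "k < v + w" for k
    using that x by (intro padic_scale_zeros[OF xQ r'(1), of v]) (auto simp: has_val_def)
  have "padic_scale p r x (v + w) \<noteq> 0"
  proof
    assume 2: "padic_scale p r x (v + w) = 0"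
    have "padic_scale p r x k = 0" if "k < v + w + 1" for k
      using that 1 2 by (cases "k = v + w") auto
    then have "padic_scale p (inverse r) (padic_scale p r x) v = 0"
      by (intro padic_scale_zeros[OF padic_scale_Qp[OF xQ] r'(2), of "v + w + 1"]) auto
    then show False using x r'(3) by (simp add: padic_scale_scale xQ padic_scale_1 has_val_def)
  qed
  with 1 show ?thesis using padic_scale_Qp[OF xQ] by (simp add: has_val_def)
qed

lemma has_val_padic_val: "has_val x v \<Longrightarrow> padic_val x = v"
  unfolding padic_val_def has_val_def by (rule Least_equality) (blast, meson leI)

lemma ex_has_val:
  assumes "x \<in> Qp p" "x \<noteq> padic_zero" shows "\<exists>v. has_val x v"
proof -
  obtain k where k: "x k \<noteq> 0" using assms(2) by (auto simp: padic_zero_def)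
  let ?K = "{j. j < k + 1 \<and> x j \<noteq> 0}"
  have fin: "finite ?K" by (rule finite_digits[OF assms(1)])
  define v where "v = Min ?K"
  have "v \<in> ?K" unfolding v_def using k by (intro Min_in fin) auto
  moreover have "x j = 0" if "j < v" for j
  proof (rule ccontr)
    assume "x j \<noteq> 0"
    then have "j \<in> ?K" using that \<open>v \<in> ?K\<close> by simp
    then have "v \<le> j" unfolding v_def by (rule Min_le[OF fin])
    then show False using that by simp
  qed
  ultimately show ?thesis using assms(1) unfolding has_val_def by blast
qed

lemma has_val_padic_val_nonzero: "x \<in> Qp p \<Longrightarrow> x \<noteq> padic_zero \<Longrightarrow> has_val x (padic_val x)"
  using ex_has_val[of x] has_val_padic_val[of x] by blast

lemma Zp_units_iff: "x \<in> Zp_units p \<longleftrightarrow> has_val x 0"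
  by (auto simp: Zp_units_def Zp_def has_val_def)

end

section \<open>Topologies on the p-adic numbers and the adeles\<close>

lemma Qp_ball_openin: "x \<in> Qp p \<Longrightarrow> openin (Qp_top p) {y \<in> Qp p. \<forall>k<N. y k = x k}"
  unfolding Qp_top_def by (rule topology_generated_by_Basis) blast

text \<open>Every point of an ultrametric ball is a centre of it, so the generating balls already
  form a base.\<close>

lemma openin_Qp_top_iff:
  "openin (Qp_top p) U \<longleftrightarrow> U \<subseteq> Qp p \<and> (\<forall>x\<in>U. \<exists>N. {y \<in> Qp p. \<forall>k<N. y k = x k} \<subseteq> U)"
proof
  assume "openin (Qp_top p) U"
  then have "generate_topology_on {{y \<in> Qp p. \<forall>k<N. y k = x k} | x N. x \<in> Qp p} U"
    by (simp add: Qp_top_def openin_topology_generated_by_iff)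
  then show "U \<subseteq> Qp p \<and> (\<forall>x\<in>U. \<exists>N. {y \<in> Qp p. \<forall>k<N. y k = x k} \<subseteq> U)"
  proof (induction rule: generate_topology_on.induct)
    case (Int a b)
    show ?case
    proof (intro conjI ballI)
      fix x assume "x \<in> a \<inter> b"
      then obtain N M where "{y \<in> Qp p. \<forall>k<N. y k = x k} \<subseteq> a" "{y \<in> Qp p. \<forall>k<M. y k = x k} \<subseteq> b"
        using Int by blast
      then have "{y \<in> Qp p. \<forall>k<max N M. y k = x k} \<subseteq> a \<inter> b" by (auto simp: less_max_iff_disj)
      then show "\<exists>N. {y \<in> Qp p. \<forall>k<N. y k = x k} \<subseteq> a \<inter> b" ..
    qed (use Int in blast)
  next
    case (UN K)
    show ?case
    proof (intro conjI ballI)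
      show "\<Union> K \<subseteq> Qp p" using UN.IH by blast
      fix x assume "x \<in> \<Union> K"
      then obtain V where V: "V \<in> K" "x \<in> V" by blast
      then obtain N where "{y \<in> Qp p. \<forall>k<N. y k = x k} \<subseteq> V" using UN.IH[OF V(1)] by blast
      then show "\<exists>N. {y \<in> Qp p. \<forall>k<N. y k = x k} \<subseteq> \<Union> K" using V(1) by (intro exI[of _ N]) blast
    qed
  next
    case (Basis s)
    then obtain x N where s: "s = {y \<in> Qp p. \<forall>k<N. y k = x k}" by blast
    show ?case
    proof (intro conjI ballI)
      fix z assume "z \<in> s"
      then show "\<exists>N. {y \<in> Qp p. \<forall>k<N. y k = z k} \<subseteq> s" by (intro exI[of _ N]) (auto simp: s)
    qed (auto simp: s)
  qed simp
next
  assume *: "U \<subseteq> Qp p \<and> (\<forall>x\<in>U. \<exists>N. {y \<in> Qp p. \<forall>k<N. y k = x k} \<subseteq> U)"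
  show "openin (Qp_top p) U"
  proof (subst openin_subopen, rule ballI)
    fix x assume x: "x \<in> U"
    then obtain N where "{y \<in> Qp p. \<forall>k<N. y k = x k} \<subseteq> U" using * by blast
    then show "\<exists>T. openin (Qp_top p) T \<and> x \<in> T \<and> T \<subseteq> U"
      using Qp_ball_openin[of x p N] x * by (intro exI[of _ "{y \<in> Qp p. \<forall>k<N. y k = x k}"]) auto
  qed
qed

lemma topspace_Qp_top: "topspace (Qp_top p) = Qp p"
proof
  show "topspace (Qp_top p) \<subseteq> Qp p" using openin_Qp_top_iff openin_topspace by blast
  have "openin (Qp_top p) (Qp p)" by (subst openin_Qp_top_iff) blast
  then show "Qp p \<subseteq> topspace (Qp_top p)" by (rule openin_subset)
qed

lemma openin_Qp_digits:
  assumes "\<And>x y. x \<in> Qp p \<Longrightarrow> y \<in> Qp p \<Longrightarrow> \<forall>k<N. y k = x k \<Longrightarrow> P x \<Longrightarrow> P y"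
  shows "openin (Qp_top p) {x \<in> Qp p. P x}"
  unfolding openin_Qp_top_iff using assms by blast

lemma Zp_Qp: "x \<in> Zp p \<Longrightarrow> x \<in> Qp p"
  by (auto simp: Zp_def)

lemma Zp_units_Zp: "x \<in> Zp_units p \<Longrightarrow> x \<in> Zp p"
  by (auto simp: Zp_units_def)

lemma Zp_units_Qp: "x \<in> Zp_units p \<Longrightarrow> x \<in> Qp p"
  by (intro Zp_Qp Zp_units_Zp)

lemma openin_Zp: "openin (Qp_top p) (Zp p)"
  using openin_Qp_digits[of p 0 "\<lambda>x. \<forall>k<0. x k = 0"] by (simp add: Zp_def)

lemma closedin_Zp_units: "closedin (Qp_top p) (Zp_units p)"
proof -
  \<comment> \<open>The digits at positions up to 0 decide whether x is a unit.\<close>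
  have "openin (Qp_top p) {x \<in> Qp p. \<not> ((\<forall>k<0. x k = 0) \<and> x 0 \<noteq> 0)}"
    by (rule openin_Qp_digits[of p 1]) auto
  moreover have "Qp p - Zp_units p = {x \<in> Qp p. \<not> ((\<forall>k<0. x k = 0) \<and> x 0 \<noteq> 0)}"
    by (auto simp: Zp_units_def Zp_def)
  ultimately show ?thesis
    using Zp_units_Qp by (auto simp: closedin_def topspace_Qp_top)
qed

text \<open>A nonzero digit persists nearby; its position depends on the point, so
  \<open>openin_Qp_digits\<close> with its fixed N does not apply.\<close>

lemma openin_Qp_nonzero: "openin (Qp_top p) {x \<in> Qp p. x \<noteq> padic_zero}"
proof (unfold openin_Qp_top_iff, intro conjI ballI)
  fix x assume "x \<in> {x \<in> Qp p. x \<noteq> padic_zero}"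
  then obtain k where "x k \<noteq> 0" by (auto simp: padic_zero_def)
  then have "{y \<in> Qp p. \<forall>j<k + 1. y j = x j} \<subseteq> {x \<in> Qp p. x \<noteq> padic_zero}"
    by (auto simp: padic_zero_def)
  then show "\<exists>N. {y \<in> Qp p. \<forall>k<N. y k = x k} \<subseteq> {x \<in> Qp p. x \<noteq> padic_zero}" ..
qed blast

lemma continuous_map_padic_scale:
  assumes p: "prime p" shows "continuous_map (Qp_top p) (Qp_top p) (padic_scale p r)"
  unfolding continuous_map_def topspace_Qp_top
proof (intro conjI allI impI)
  show "padic_scale p r \<in> Qp p \<rightarrow> Qp p" using padic_scale_Qp[OF p] by blast
  fix U assume U: "openin (Qp_top p) U"
  obtain v where v: "in_pZ p v r" using ex_in_pZ[OF p] by blast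
  show "openin (Qp_top p) {x \<in> Qp p. padic_scale p r x \<in> U}"
  proof (unfold openin_Qp_top_iff, intro conjI ballI)
    fix x assume x: "x \<in> {x \<in> Qp p. padic_scale p r x \<in> U}"
    then obtain N where N: "{y \<in> Qp p. \<forall>k<N. y k = padic_scale p r x k} \<subseteq> U"
      using U by (auto simp: openin_Qp_top_iff)
    have "padic_scale p r y \<in> U" if y: "y \<in> Qp p" "\<forall>k<N - v. y k = x k" for y
    proof -
      have "\<forall>k<N. padic_scale p r y k = padic_scale p r x k"
        using padic_scale_cong[OF p y(1) _ v, of x N] x y(2) by auto
      then show ?thesis using N padic_scale_Qp[OF p y(1)] by auto
    qed
    then have "{y \<in> Qp p. \<forall>k<N - v. y k = x k} \<subseteq> {x \<in> Qp p. padic_scale p r x \<in> U}" by blast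
    then show "\<exists>N. {y \<in> Qp p. \<forall>k<N. y k = x k} \<subseteq> {x \<in> Qp p. padic_scale p r x \<in> U}" ..
  qed blast
qed

section \<open>The restricted product topology on the finite adeles\<close>

lemma Af_Qp: "a \<in> Af \<Longrightarrow> p \<in> primes_set \<Longrightarrow> a p \<in> Qp p"
  by (auto simp: Af_def)

lemma openin_Af_basic:
  assumes "finite S" "S \<subseteq> primes_set" "\<And>p. p \<in> S \<Longrightarrow> openin (Qp_top p) (U p)"
  shows "openin Af_top {a \<in> Af. (\<forall>p\<in>S. a p \<in> U p) \<and> (\<forall>p\<in>primes_set - S. a p \<in> Zp p)}"
  unfolding Af_top_def by (rule topology_generated_by_Basis) (use assms in blast)

lemma topspace_Af_top: "topspace Af_top = Af"
proof
  show "topspace Af_top \<subseteq> Af" unfolding Af_top_def topology_generated_by_topspace by blast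
  show "Af \<subseteq> topspace Af_top"
  proof
    fix a assume a: "a \<in> Af"
    let ?S = "{p \<in> primes_set. a p \<notin> Zp p}"
    have "openin Af_top {b \<in> Af. (\<forall>p\<in>?S. b p \<in> Qp p) \<and> (\<forall>p\<in>primes_set - ?S. b p \<in> Zp p)}"
      using a by (intro openin_Af_basic) (auto simp: Af_def simp flip: topspace_Qp_top)
    from openin_subset[OF this] show "a \<in> topspace Af_top" using a by (auto simp: Af_Qp)
  qed
qed

text \<open>For finite S one precision M can serve all places of S; every open set contains such a
  set around each of its points (\<open>openin_Af_nbhd\<close>).\<close>

definition Af_nbhd :: "(nat \<Rightarrow> padic) \<Rightarrow> nat set \<Rightarrow> int \<Rightarrow> (nat \<Rightarrow> padic) set" where
  "Af_nbhd a S M = {b \<in> Af. (\<forall>p\<in>S. \<forall>k<M. b p k = a p k) \<and> (\<forall>p\<in>primes_set - S. b p \<in> Zp p)}"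

text \<open>The condition \<open>0 \<le> M\<close> makes the neighbourhoods directed: at a place of S where a is
  integral, agreement below position M forces integrality.\<close>
lemma openin_Af_nbhd:
  assumes "openin Af_top W" "a \<in> W"
  obtains S M where "finite S" "S \<subseteq> primes_set" "0 \<le> M" "\<forall>p\<in>primes_set - S. a p \<in> Zp p" "Af_nbhd a S M \<subseteq> W"
proof -
  define \<B> where "\<B> = {{a \<in> Af. (\<forall>p\<in>S. a p \<in> U p) \<and> (\<forall>p\<in>primes_set - S. a p \<in> Zp p)} | S U.
        finite S \<and> S \<subseteq> primes_set \<and> (\<forall>p\<in>S. openin (Qp_top p) (U p))}"
  have "generate_topology_on \<B> W"
    using assms(1) unfolding Af_top_def \<B>_def by (rule openin_topology_generated_by)
  then have "\<forall>a\<in>W. \<exists>S M. finite S \<and> S \<subseteq> primes_set \<and> 0 \<le> M \<and> (\<forall>p\<in>primes_set - S. a p \<in> Zp p) \<and> Af_nbhd a S M \<subseteq> W"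
  proof (induction rule: generate_topology_on.induct)
    case (Int V W)
    show ?case
    proof
      fix a assume "a \<in> V \<inter> W"
      then have a: "a \<in> V" "a \<in> W" by auto
      obtain S M where S: "finite S" "S \<subseteq> primes_set" "0 \<le> M" "\<forall>p\<in>primes_set - S. a p \<in> Zp p" "Af_nbhd a S M \<subseteq> V"
        using bspec[OF Int.IH(1) a(1)] by blast
      obtain S' M' where S': "finite S'" "S' \<subseteq> primes_set" "0 \<le> M'" "\<forall>p\<in>primes_set - S'. a p \<in> Zp p" "Af_nbhd a S' M' \<subseteq> W"
        using bspec[OF Int.IH(2) a(2)] by blast
      \<comment> \<open>Stated so that it serves both neighbourhoods, with the roles of S and S'
        exchanged.\<close>
      have sub: "Af_nbhd a (T \<union> T') (max L L') \<subseteq> Af_nbhd a T L"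
        if "T' \<subseteq> primes_set" "0 \<le> L" and aT: "\<forall>p\<in>primes_set - T. a p \<in> Zp p" for T T' L L'
      proof
        fix b assume b: "b \<in> Af_nbhd a (T \<union> T') (max L L')"
        have "b p \<in> Zp p" if p: "p \<in> primes_set - T" for p
        proof (cases "p \<in> T'")
          case True
          then have "\<forall>k<0. b p k = a p k" using b \<open>0 \<le> L\<close> by (auto simp: Af_nbhd_def)
          moreover have "a p \<in> Zp p" "b p \<in> Qp p" using aT p b Af_Qp by (auto simp: Af_nbhd_def)
          ultimately show ?thesis by (auto simp: Zp_def)
        next
          case False
          then show ?thesis using b p by (auto simp: Af_nbhd_def)
        qed
        then show "b \<in> Af_nbhd a T L" using b by (auto simp: Af_nbhd_def)
      qed
      have "Af_nbhd a (S \<union> S') (max M M') \<subseteq> V \<inter> W"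
        using sub[of S' M S M'] sub[of S M' S' M] S S' by (auto simp: Un_commute max.commute)
      then show "\<exists>S M. finite S \<and> S \<subseteq> primes_set \<and> 0 \<le> M \<and> (\<forall>p\<in>primes_set - S. a p \<in> Zp p) \<and> Af_nbhd a S M \<subseteq> V \<inter> W"
        using S S' by (intro exI[of _ "S \<union> S'"] exI[of _ "max M M'"]) auto
    qed
  next
    case (UN K)
    show ?case
    proof
      fix a assume "a \<in> \<Union> K"
      then obtain V where V: "V \<in> K" "a \<in> V" by blast
      from bspec[OF UN.IH[OF V(1)] V(2)] show "\<exists>S M. finite S \<and> S \<subseteq> primes_set \<and> 0 \<le> M
          \<and> (\<forall>p\<in>primes_set - S. a p \<in> Zp p) \<and> Af_nbhd a S M \<subseteq> \<Union> K"
        using V(1) by (elim exE conjE) (intro exI conjI, assumption+, blast)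
    qed
  next
    case (Basis s)
    then obtain S U where s: "s = {a \<in> Af. (\<forall>p\<in>S. a p \<in> U p) \<and> (\<forall>p\<in>primes_set - S. a p \<in> Zp p)}"
      and S: "finite S" "S \<subseteq> primes_set" and U: "\<forall>p\<in>S. openin (Qp_top p) (U p)" unfolding \<B>_def by blast
    show ?case
    proof
      fix a assume a: "a \<in> s"
      then have "\<forall>p\<in>S. \<exists>N. {y \<in> Qp p. \<forall>k<N. y k = a p k} \<subseteq> U p"
        using U by (auto simp: openin_Qp_top_iff s)
      then have "\<exists>N. \<forall>p\<in>S. {y \<in> Qp p. \<forall>k<N p. y k = a p k} \<subseteq> U p" by (rule bchoice)
      then obtain N where N: "\<forall>p\<in>S. {y \<in> Qp p. \<forall>k<N p. y k = a p k} \<subseteq> U p" ..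
      define M where "M = Max (insert 0 (N ` S))"
      have M: "0 \<le> M" "\<And>p. p \<in> S \<Longrightarrow> N p \<le> M" using S(1) by (auto simp: M_def)
      have "Af_nbhd a S M \<subseteq> s"
      proof
        fix b assume b: "b \<in> Af_nbhd a S M"
        have "b p \<in> U p" if "p \<in> S" for p
        proof (rule subsetD[OF bspec[OF N that]])
          have "b p \<in> Qp p" using b that S(2) Af_Qp by (auto simp: Af_nbhd_def)
          moreover have "b p k = a p k" if "k < N p" for k
            using b \<open>p \<in> S\<close> that M(2)[OF \<open>p \<in> S\<close>] by (auto simp: Af_nbhd_def)
          ultimately show "b p \<in> {y \<in> Qp p. \<forall>k<N p. y k = a p k}" by blast
        qed
        then show "b \<in> s" using b by (auto simp: s Af_nbhd_def)
      qed
      then show "\<exists>S M. finite S \<and> S \<subseteq> primes_set \<and> 0 \<le> M \<and> (\<forall>p\<in>primes_set - S. a p \<in> Zp p) \<and> Af_nbhd a S M \<subseteq> s"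
        using S M(1) a by (intro exI[of _ S] exI[of _ M]) (auto simp: s)
    qed
  qed simp
  then show ?thesis using that assms(2) by blast
qed

lemma continuous_map_Af_component:
  assumes q: "q \<in> primes_set" shows "continuous_map Af_top (Qp_top q) (\<lambda>a. a q)"
  unfolding continuous_map_def topspace_Qp_top topspace_Af_top
proof (intro conjI allI impI)
  show "(\<lambda>a. a q) \<in> Af \<rightarrow> Qp q" using q Af_Qp by blast
  fix U assume U: "openin (Qp_top q) U"
  show "openin Af_top {a \<in> Af. a q \<in> U}"
  proof (subst openin_subopen, rule ballI)
    fix a assume a: "a \<in> {a \<in> Af. a q \<in> U}"
    \<comment> \<open>A basic open set demands integrality outside its index set, so the finitely
      many non-integral places of a are added to q, with no restriction imposed there.\<close>
    let ?S = "insert q {p \<in> primes_set. a p \<notin> Zp p}"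
    let ?U = "\<lambda>p. if p = q then U else Qp p"
    have "openin Af_top {b \<in> Af. (\<forall>p\<in>?S. b p \<in> ?U p) \<and> (\<forall>p\<in>primes_set - ?S. b p \<in> Zp p)}"
      using a q U by (intro openin_Af_basic) (auto simp: Af_def simp flip: topspace_Qp_top)
    then show "\<exists>T. openin Af_top T \<and> a \<in> T \<and> T \<subseteq> {a \<in> Af. a q \<in> U}"
      using a by (intro exI[of _ "{b \<in> Af. (\<forall>p\<in>?S. b p \<in> ?U p) \<and> (\<forall>p\<in>primes_set - ?S. b p \<in> Zp p)}"] conjI)
        (auto simp: Af_Qp)
  qed
qed

section \<open>Neighbourhoods and components of adeles\<close>

lemma topspace_adele_top: "topspace adele_top = adeles"
  by (simp add: adele_top_def adeles_def topspace_Af_top)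

lemma openin_adele_nbhd:
  assumes "openin adele_top W" "a \<in> W"
  obtains S M \<delta> where "finite S" "S \<subseteq> primes_set" "0 \<le> M" "\<forall>p\<in>primes_set - S. fst a p \<in> Zp p" "\<delta> > 0"
    "\<And>b. fst b \<in> Af_nbhd (fst a) S M \<Longrightarrow> \<bar>snd b - snd a\<bar> < \<delta> \<Longrightarrow> b \<in> W"
proof -
  obtain U V where UV: "openin Af_top U" "open V" "fst a \<in> U" "snd a \<in> V" "U \<times> V \<subseteq> W"
    using assms unfolding adele_top_def openin_prod_topology_alt by (metis prod.collapse open_openin)
  obtain S M where S: "finite S" "S \<subseteq> primes_set" "0 \<le> M" "\<forall>p\<in>primes_set - S. fst a p \<in> Zp p" "Af_nbhd (fst a) S M \<subseteq> U"
    using openin_Af_nbhd[OF UV(1,3)] .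
  obtain \<delta> where \<delta>: "\<delta> > 0" "\<And>y. \<bar>y - snd a\<bar> < \<delta> \<Longrightarrow> y \<in> V"
    using UV(2,4) by (auto simp: open_dist dist_real_def)
  show ?thesis using S \<delta> UV(5) by (intro that[of S M \<delta>]) (auto simp: subset_iff mem_Times_iff)
qed

lemma continuous_map_adele_component:
  "p \<in> primes_set \<Longrightarrow> continuous_map adele_top (Qp_top p) (\<lambda>a. fst a p)"
  unfolding adele_top_def
  using continuous_map_compose[OF continuous_map_fst continuous_map_Af_component] by (simp add: o_def)

lemma continuous_map_adele_real: "continuous_map adele_top euclideanreal snd"
  unfolding adele_top_def by (rule continuous_map_snd)

section \<open>The action of rationals on adeles\<close>

definition adele_scale :: "rat \<Rightarrow> adele \<Rightarrow> adele" where
  "adele_scale r a = ((\<lambda>p\<in>primes_set. padic_scale p r (fst a p)), real_of_rat r * snd a)"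

lemma padic_scale_Zp:
  assumes p: "prime p" and x: "x \<in> Zp p" and r: "in_pZ p 0 r" shows "padic_scale p r x \<in> Zp p"
  using x padic_scale_Qp[OF p, of x r] padic_scale_zeros[OF p _ r, of x 0] by (auto simp: Zp_def)

text \<open>Only primes dividing the numerator or the denominator are exceptional. This is what
  makes scaling compatible with the restricted product.\<close>

lemma finite_pval_nonzero:
  assumes "r \<noteq> 0" shows "finite {p \<in> primes_set. \<not> has_pval p 0 r}"
proof -
  obtain a b where ab: "b > 0" "r = rat_of_int a / rat_of_int b"
    using quotient_of_div quotient_of_denom_pos by (metis surj_pair)
  then have "a * b \<noteq> 0" using assms by auto
  have "has_pval p 0 r" if p: "prime p" "\<not> int p dvd a * b" for p
  proof -
    have "\<not> int p dvd a" "\<not> int p dvd b" using p by auto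
    then show ?thesis
      using has_pval_mult[OF p(1) has_pval_unit[OF p(1)] has_pval_inverse[OF p(1) has_pval_unit[OF p(1)]], of a b] ab(2)
      by (simp add: divide_inverse)
  qed
  then have "{p \<in> primes_set. \<not> has_pval p 0 r} \<subseteq> {p. p dvd nat \<bar>a * b\<bar>}"
    by (auto simp: primes_set_def)
  moreover have "finite {p. p dvd nat \<bar>a * b\<bar>}"
    using \<open>a * b \<noteq> 0\<close> by (intro finite_divisors_nat) linarith
  ultimately show ?thesis by (rule finite_subset)
qed

lemma finite_not_in_pZ: "finite {p \<in> primes_set. \<not> in_pZ p 0 r}"
proof (cases "r = 0")
  case True
  then have "{p \<in> primes_set. \<not> in_pZ p 0 r} = {}" using in_pZ_0 by (auto simp: primes_set_def)
  then show ?thesis by (simp only: finite.emptyI)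
next
  case False
  have "{p \<in> primes_set. \<not> in_pZ p 0 r} \<subseteq> {p \<in> primes_set. \<not> has_pval p 0 r}"
    by (auto simp: primes_set_def has_pval_def)
  then show ?thesis using finite_pval_nonzero[OF False] by (rule finite_subset)
qed

lemma adele_scale_adeles:
  assumes a: "a \<in> adeles" shows "adele_scale r a \<in> adeles"
proof -
  define b where "b = (\<lambda>p\<in>primes_set. padic_scale p r (fst a p))"
  have a': "fst a \<in> Af" using a by (auto simp: adeles_def)
  have b_eq: "b p = padic_scale p r (fst a p)" if "p \<in> primes_set" for p using that by (simp add: b_def)
  have "{p \<in> primes_set. b p \<notin> Zp p}
      \<subseteq> {p \<in> primes_set. fst a p \<notin> Zp p} \<union> {p \<in> primes_set. \<not> in_pZ p 0 r}"
    using padic_scale_Zp b_eq by (auto simp: primes_set_def)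
  moreover have "finite {p \<in> primes_set. fst a p \<notin> Zp p}" using a' unfolding Af_def by blast
  ultimately have "finite {p \<in> primes_set. b p \<notin> Zp p}"
    using finite_not_in_pZ[of r] by (meson finite_UnI finite_subset)
  moreover have "b \<in> (\<Pi>\<^sub>E p\<in>primes_set. Qp p)"
    unfolding b_def using padic_scale_Qp Af_Qp[OF a'] by (intro restrict_PiE_iff[THEN iffD2]) (simp add: primes_set_def)
  ultimately have "b \<in> Af" unfolding Af_def by blast
  then show ?thesis by (simp add: adele_scale_def adeles_def b_def)
qed

lemma adele_scale_1:
  assumes a: "a \<in> adeles" shows "adele_scale 1 a = a"
proof -
  have a': "fst a \<in> Af" using a by (auto simp: adeles_def)
  have "(\<lambda>p\<in>primes_set. padic_scale p 1 (fst a p)) = fst a"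
  proof
    fix p show "(\<lambda>p\<in>primes_set. padic_scale p 1 (fst a p)) p = fst a p"
    proof (cases "p \<in> primes_set")
      case True
      then show ?thesis using padic_scale_1 Af_Qp[OF a' True] by (simp add: primes_set_def)
    next
      case False
      then show ?thesis using a' PiE_arb[of "fst a" primes_set Qp p] by (simp add: Af_def)
    qed
  qed
  then show ?thesis by (simp add: adele_scale_def)
qed

lemma adele_scale_scale: "a \<in> adeles \<Longrightarrow> adele_scale s (adele_scale r a) = adele_scale (s * r) a"
proof -
  assume "a \<in> adeles"
  then have "fst a \<in> Af" by (auto simp: adeles_def)
  then have "padic_scale p s (padic_scale p r (fst a p)) = padic_scale p (s * r) (fst a p)"
    if "p \<in> primes_set" for p
    using that padic_scale_scale Af_Qp by (simp add: primes_set_def)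
  then show ?thesis
    unfolding adele_scale_def by (simp add: of_rat_mult cong: restrict_cong)
qed

text \<open>At almost all primes r is a p-adic unit and scaling preserves integrality in both
  directions, so the preimage of a basic open set is basic for an enlarged index set.\<close>

lemma continuous_map_adele_scale:
  assumes r: "r \<noteq> 0" shows "continuous_map adele_top adele_top (adele_scale r)"
proof -
  let ?f = "\<lambda>a. \<lambda>p\<in>primes_set. padic_scale p r (a p)"
  have f_Af: "?f a \<in> Af" if "a \<in> Af" for a
    using adele_scale_adeles[of "(a, 0)" r] that by (simp add: adeles_def adele_scale_def)
  have cont_f: "continuous_map Af_top Af_top ?f"
    unfolding Af_top_def
  proof (rule continuous_on_generated_topo, fold Af_top_def)
    fix W assume "W \<in> {{a \<in> Af. (\<forall>p\<in>S. a p \<in> U p) \<and> (\<forall>p\<in>primes_set - S. a p \<in> Zp p)} | S U.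
        finite S \<and> S \<subseteq> primes_set \<and> (\<forall>p\<in>S. openin (Qp_top p) (U p))}"
    then obtain S U where W: "W = {a \<in> Af. (\<forall>p\<in>S. a p \<in> U p) \<and> (\<forall>p\<in>primes_set - S. a p \<in> Zp p)}"
      and S: "finite S" "S \<subseteq> primes_set" and U: "\<forall>p\<in>S. openin (Qp_top p) (U p)" by blast
    define S' where "S' = S \<union> {p \<in> primes_set. \<not> has_pval p 0 r}"
    \<comment> \<open>At the added primes integrality need not be preserved, so it is pulled back as
      an ordinary open condition.\<close>
    define U' where "U' p = {x \<in> Qp p. padic_scale p r x \<in> (if p \<in> S then U p else Zp p)}" for p
    have S': "finite S'" "S' \<subseteq> primes_set" using S finite_pval_nonzero[OF r] by (auto simp: S'_def)
    have U': "openin (Qp_top p) (U' p)" if "p \<in> S'" for p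
      using openin_continuous_map_preimage[OF continuous_map_padic_scale, of p "if p \<in> S then U p else Zp p" r]
        that S' U openin_Zp by (auto simp: U'_def topspace_Qp_top primes_set_def)
    have scale_Zp: "padic_scale p r x \<in> Zp p \<longleftrightarrow> x \<in> Zp p" if "p \<in> primes_set - S'" "x \<in> Qp p" for p x
    proof -
      have p: "prime p" "in_pZ p 0 r" "in_pZ p 0 (inverse r)"
        using that(1) by (auto simp: S'_def primes_set_def has_pval_def)
      have "padic_scale p (inverse r) (padic_scale p r x) = x"
        using that(2) p(1) r by (simp add: padic_scale_scale padic_scale_1)
      then show ?thesis using padic_scale_Zp[OF p(1) _ p(2)] padic_scale_Zp[OF p(1) _ p(3)] by metis
    qed
    have "?f -` W \<inter> topspace Af_top
        = {a \<in> Af. (\<forall>p\<in>S'. a p \<in> U' p) \<and> (\<forall>p\<in>primes_set - S'. a p \<in> Zp p)}"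
    proof (intro set_eqI iffI)
      fix a assume "a \<in> ?f -` W \<inter> topspace Af_top"
      then have a: "a \<in> Af" "?f a \<in> W" by (auto simp: topspace_Af_top)
      have "a p \<in> U' p" if "p \<in> S'" for p
        using a that subsetD[OF S'(2) that] Af_Qp[OF a(1)] by (auto simp: W U'_def)
      moreover have "a p \<in> Zp p" if "p \<in> primes_set - S'" for p
        using a that scale_Zp[OF that Af_Qp[OF a(1)]] by (auto simp: W S'_def)
      ultimately show "a \<in> {a \<in> Af. (\<forall>p\<in>S'. a p \<in> U' p) \<and> (\<forall>p\<in>primes_set - S'. a p \<in> Zp p)}"
        using a(1) by blast
    next
      fix a assume a: "a \<in> {a \<in> Af. (\<forall>p\<in>S'. a p \<in> U' p) \<and> (\<forall>p\<in>primes_set - S'. a p \<in> Zp p)}"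
      have "?f a p \<in> U p" if "p \<in> S" for p
      proof -
        have "p \<in> S'" "p \<in> primes_set" using that S(2) by (auto simp: S'_def)
        then have "a p \<in> U' p" using a by blast
        then show ?thesis using that \<open>p \<in> primes_set\<close> by (simp add: U'_def)
      qed
      moreover have "?f a p \<in> Zp p" if "p \<in> primes_set - S" for p
      proof (cases "p \<in> S'")
        case True
        then show ?thesis using a that by (auto simp: U'_def)
      next
        case False
        then show ?thesis using a that scale_Zp[of p "a p"] Af_Qp[of a p] by auto
      qed
      ultimately show "a \<in> ?f -` W \<inter> topspace Af_top"
        using a f_Af by (auto simp: W topspace_Af_top)
    qed
    then show "openin Af_top (?f -` W \<inter> topspace Af_top)"
      using openin_Af_basic[OF S' U'] by simp
  next
    show "?f ` topspace Af_top \<subseteq> \<Union> {{a \<in> Af. (\<forall>p\<in>S. a p \<in> U p) \<and> (\<forall>p\<in>primes_set - S. a p \<in> Zp p)} | S U.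
        finite S \<and> S \<subseteq> primes_set \<and> (\<forall>p\<in>S. openin (Qp_top p) (U p))}"
      using f_Af topspace_Af_top unfolding Af_top_def topology_generated_by_topspace by blast
  qed
  have "continuous_map adele_top Af_top (\<lambda>a. ?f (fst a))"
    using continuous_map_compose[OF continuous_map_fst cont_f] by (simp add: adele_top_def o_def)
  moreover have "continuous_map adele_top euclideanreal (\<lambda>a. real_of_rat r * snd a)"
    by (intro continuous_map_real_mult_left continuous_map_adele_real)
  ultimately show ?thesis
    unfolding adele_top_def[of] by (subst continuous_map_pairwise) (simp add: o_def adele_scale_def adele_top_def)
qed

section \<open>The group of units as a subspace of the adeles\<close>

lemma units_U_subset_adeles: "units_U \<subseteq> adeles"
proof
  fix c assume "c \<in> units_U"
  then have "fst c \<in> (\<Pi>\<^sub>E p\<in>primes_set. Zp p)"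
    by (auto simp: units_U_def PiE_iff Zp_units_Zp)
  moreover from this have "finite {p \<in> primes_set. fst c p \<notin> Zp p}"
    by (rule_tac finite_subset[of _ "{}"]) auto
  ultimately show "c \<in> adeles"
    by (cases c) (auto simp: adeles_def Af_def PiE_iff Zp_Qp)
qed

lemma topspace_units_top: "topspace units_top = units_U"
  by (auto simp: units_top_def units_U_def topspace_Qp_top PiE_iff Zp_units_Qp)

text \<open>Units are integral everywhere, so a basic open set of adeles restricts only finitely
  many of their components. With \<open>continuous_map_adele_units\<close> this identifies
  \<open>units_top\<close> with the topology induced from the adeles.\<close>

lemma continuous_map_units_adele: "continuous_map units_top adele_top id"
proof -
  let ?X = "product_topology (\<lambda>p. subtopology (Qp_top p) (Zp_units p)) primes_set"
  have top: "topspace ?X = (\<Pi>\<^sub>E p\<in>primes_set. Zp_units p)"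
    by (auto simp: topspace_Qp_top PiE_iff Zp_units_Qp)
  have sub: "(\<Pi>\<^sub>E p\<in>primes_set. Zp_units p) \<subseteq> Af"
  proof
    fix x assume "x \<in> (\<Pi>\<^sub>E p\<in>primes_set. Zp_units p)"
    then have "(x, 1) \<in> units_U" by (simp add: units_U_def)
    then show "x \<in> Af" using units_U_subset_adeles by (auto simp: adeles_def)
  qed
  have "continuous_map ?X Af_top id"
    unfolding Af_top_def
  proof (rule continuous_on_generated_topo)
    fix W assume "W \<in> {{a \<in> Af. (\<forall>p\<in>S. a p \<in> U p) \<and> (\<forall>p\<in>primes_set - S. a p \<in> Zp p)} | S U.
        finite S \<and> S \<subseteq> primes_set \<and> (\<forall>p\<in>S. openin (Qp_top p) (U p))}"
    then obtain S U where W: "W = {a \<in> Af. (\<forall>p\<in>S. a p \<in> U p) \<and> (\<forall>p\<in>primes_set - S. a p \<in> Zp p)}"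
      and S: "finite S" "S \<subseteq> primes_set" and U: "\<forall>p\<in>S. openin (Qp_top p) (U p)" by blast
    define U' where "U' p = (if p \<in> S then U p \<inter> Zp_units p else Zp_units p)" for p
    have "id -` W \<inter> topspace ?X = (\<Pi>\<^sub>E p\<in>primes_set. U' p)"
    proof (intro set_eqI iffI)
      fix a assume "a \<in> id -` W \<inter> topspace ?X"
      then show "a \<in> (\<Pi>\<^sub>E p\<in>primes_set. U' p)" unfolding top by (auto simp: W U'_def PiE_iff)
    next
      fix a assume a: "a \<in> (\<Pi>\<^sub>E p\<in>primes_set. U' p)"
      then have mem: "a p \<in> U' p" if "p \<in> primes_set" for p using that by auto
      have *: "a p \<in> Zp_units p" "p \<in> S \<Longrightarrow> a p \<in> U p" if "p \<in> primes_set" for p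
        using mem[OF that] by (auto simp: U'_def split: if_splits)
      then have "a \<in> (\<Pi>\<^sub>E p\<in>primes_set. Zp_units p)" using a by (auto simp: PiE_iff)
      then show "a \<in> id -` W \<inter> topspace ?X"
        unfolding top using * sub S(2) by (auto simp: W Zp_units_Zp)
    qed
    moreover have "openin ?X (\<Pi>\<^sub>E p\<in>primes_set. U' p)"
    proof (rule openin_PiE_gen[THEN iffD2], intro disjI2 conjI ballI)
      show "finite {p \<in> primes_set. U' p \<noteq> topspace (subtopology (Qp_top p) (Zp_units p))}"
        by (intro finite_subset[OF _ S(1)]) (auto simp: U'_def topspace_Qp_top Zp_units_Qp)
      show "openin (subtopology (Qp_top p) (Zp_units p)) (U' p)" if "p \<in> primes_set" for p
      proof (cases "p \<in> S")
        case True
        then show ?thesis using U by (auto simp: U'_def openin_subtopology_Int)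
      next
        case False
        then show ?thesis
          using openin_topspace[of "subtopology (Qp_top p) (Zp_units p)"]
          by (simp add: U'_def topspace_Qp_top Int_absorb1 subsetI Zp_units_Qp)
      qed
    qed
    ultimately show "openin ?X (id -` W \<inter> topspace ?X)" by simp
  next
    show "id ` topspace ?X \<subseteq> \<Union> {{a \<in> Af. (\<forall>p\<in>S. a p \<in> U p) \<and> (\<forall>p\<in>primes_set - S. a p \<in> Zp p)} | S U.
        finite S \<and> S \<subseteq> primes_set \<and> (\<forall>p\<in>S. openin (Qp_top p) (U p))}"
      using sub topspace_Af_top unfolding Af_top_def topology_generated_by_topspace top by auto
  qed
  moreover have "continuous_map (subtopology euclideanreal {0<..}) euclideanreal id"
    using continuous_map_from_subtopology[OF continuous_map_id] .
  ultimately have "continuous_map units_top adele_top (\<lambda>(x, y). (id x, id y))"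
    unfolding units_top_def adele_top_def by (simp only: continuous_map_prod_top) blast
  then show ?thesis by (simp add: id_def case_prod_unfold)
qed

lemma continuous_map_adele_units: "continuous_map (subtopology adele_top units_U) units_top id"
proof -
  have sub: "units_U \<subseteq> topspace adele_top" using units_U_subset_adeles by (simp add: topspace_adele_top)
  have "continuous_map (subtopology adele_top units_U) (subtopology (Qp_top p) (Zp_units p)) (\<lambda>a. fst a p)"
    if "p \<in> primes_set" for p
    using that continuous_map_from_subtopology[OF continuous_map_adele_component[OF that]]
    by (intro continuous_map_into_subtopology) (auto simp: units_U_def)
  then have "continuous_map (subtopology adele_top units_U)
      (product_topology (\<lambda>p. subtopology (Qp_top p) (Zp_units p)) primes_set) fst"
    by (subst continuous_map_componentwise) (auto simp: units_U_def PiE_iff)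
  moreover have "continuous_map (subtopology adele_top units_U) (subtopology euclideanreal {0<..}) snd"
    by (intro continuous_map_into_subtopology continuous_map_from_subtopology continuous_map_adele_real)
      (auto simp: units_U_def)
  ultimately show ?thesis
    unfolding units_top_def by (subst continuous_map_pairwise) (simp add: o_def)
qed

text \<open>D is closed relative to \<open>units_U\<close>, which is not closed in the adeles
  because real components may tend to 0; the cut-off at \<epsilon> supplies a closed set between D
  and \<open>units_U\<close>.\<close>

lemma closedin_adele_units:
  assumes D: "closedin units_top D" and "\<epsilon> > 0" and ge: "\<And>c. c \<in> D \<Longrightarrow> \<epsilon> \<le> snd c"
  shows "closedin adele_top D"
proof -
  let ?V = "{a \<in> adeles. (\<forall>p\<in>primes_set. fst a p \<in> Zp_units p) \<and> \<epsilon> \<le> snd a}"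
  have V: "?V = {a \<in> adeles. \<epsilon> \<le> snd a} \<inter> (\<Inter>p\<in>primes_set. {a \<in> adeles. fst a p \<in> Zp_units p})"
    by auto
  have "closedin adele_top ({a \<in> adeles. \<epsilon> \<le> snd a} \<inter> (\<Inter>p\<in>primes_set. {a \<in> adeles. fst a p \<in> Zp_units p}))"
  proof (intro closedin_Int closedin_Inter)
    show "closedin adele_top {a \<in> adeles. \<epsilon> \<le> snd a}"
      using closedin_continuous_map_preimage[OF continuous_map_adele_real, of "{\<epsilon>..}"]
      by (simp add: topspace_adele_top)
    show "(\<lambda>p. {a \<in> adeles. fst a p \<in> Zp_units p}) ` primes_set \<noteq> {}"
      using two_is_prime_nat by (auto simp: primes_set_def)
    fix T assume "T \<in> (\<lambda>p. {a \<in> adeles. fst a p \<in> Zp_units p}) ` primes_set"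
    then show "closedin adele_top T"
      using closedin_continuous_map_preimage[OF continuous_map_adele_component closedin_Zp_units]
      by (auto simp: topspace_adele_top)
  qed
  then have closedV: "closedin adele_top ?V" by (simp only: V)
  have VU: "?V \<subseteq> units_U"
    using \<open>\<epsilon> > 0\<close> by (auto simp: units_U_def adeles_def Af_def PiE_iff extensional_def)
  have DV: "D \<subseteq> ?V"
  proof
    fix c assume c: "c \<in> D"
    then have "c \<in> units_U" using closedin_subset[OF D] by (auto simp: topspace_units_top)
    then show "c \<in> ?V" using ge[OF c] units_U_subset_adeles by (auto simp: units_U_def)
  qed
  have "closedin (subtopology adele_top units_U) D"
  proof -
    have "{x \<in> topspace (subtopology adele_top units_U). id x \<in> D} = D"
      using closedin_subset[OF D] units_U_subset_adeles by (auto simp: topspace_units_top topspace_adele_top)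
    then show ?thesis using closedin_continuous_map_preimage[OF continuous_map_adele_units D] by simp
  qed
  then obtain K where "closedin adele_top K" "D = K \<inter> units_U"
    by (auto simp: closedin_subtopology)
  then have "D = K \<inter> ?V" using DV VU by blast
  then show ?thesis using closedV \<open>closedin adele_top K\<close> by (simp add: closedin_Int)
qed


section \<open>Invertible adeles and the map chi\<close>

text \<open>Taken on all adeles, also on invertible ones where it is empty; in this form it is
  continuous on the whole ring (\<open>continuous_map_zero_places\<close>).\<close>

definition zero_places :: "adele \<Rightarrow> nat option set" where
  "zero_places a = {v \<in> places. case v of None \<Rightarrow> snd a = 0 | Some p \<Rightarrow> fst a p = padic_zero}"

lemma Some_in_zero_places: "Some p \<in> zero_places a \<longleftrightarrow> p \<in> primes_set \<and> fst a p = padic_zero"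
  by (auto simp: zero_places_def places_def)

lemma None_in_zero_places: "None \<in> zero_places a \<longleftrightarrow> snd a = 0"
  by (auto simp: zero_places_def places_def)

lemma zero_places_subset: "zero_places a \<subseteq> places"
  unfolding zero_places_def by blast

lemma zero_places_invertible: "adele_invertible a \<Longrightarrow> zero_places a = {}"
  unfolding zero_places_def adele_invertible_def places_def by (auto split: option.splits)

lemma chi_invertible: "adele_invertible a \<Longrightarrow> chi a = Inr (adele_scale (chi_factor a) a)"
  by (simp add: chi_def adele_scale_def)

lemma chi_not_invertible: "\<not> adele_invertible a \<Longrightarrow> chi a = Inl (zero_places a)"
  by (simp add: chi_def zero_places_def)

section \<open>Rationals determined by their valuations at all primes\<close>

lemma has_pval_prime_power:
  assumes p: "prime p" and q: "prime q" and "p \<noteq> q"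
  shows "has_pval p 0 (rat_of_nat q powi k)"
proof -
  have "has_pval p 0 (rat_of_int (int q ^ n))" for n
  proof (rule has_pval_unit[OF p])
    show "\<not> int p dvd int q ^ n"
      using assms by (metis int_dvd_int_iff of_nat_power prime_dvd_power primes_dvd_imp_eq)
  qed
  then have pos: "has_pval p 0 (rat_of_nat q ^ n)" for n by simp
  show ?thesis
  proof (cases "0 \<le> k")
    case True
    then show ?thesis using pos[of "nat k"] by (simp add: power_int_def)
  next
    case False
    then show ?thesis using has_pval_inverse[OF p pos, of "nat (- k)"] by (simp add: power_int_def power_inverse)
  qed
qed

lemma has_pval_prod_prime_powers:
  assumes p: "prime p" and "finite T" "T \<subseteq> primes_set"
  shows "has_pval p (if p \<in> T then e p else 0) (\<Prod>q\<in>T. rat_of_nat q powi e q)"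
  using assms(2,3)
proof (induction T rule: finite_induct)
  case empty
  show ?case using has_pval_unit[OF p not_p_dvd_1[OF p]] by simp
next
  case (insert q T)
  have q: "prime q" using insert.prems by (simp add: primes_set_def)
  have IH: "has_pval p (if p \<in> T then e p else 0) (\<Prod>q\<in>T. rat_of_nat q powi e q)"
    using insert by blast
  show ?case
  proof (cases "p = q")
    case True
    then show ?thesis
      using has_pval_mult[OF p has_pval_powi[OF p, of "e p"] IH] insert.hyps by simp
  next
    case False
    then show ?thesis
      using has_pval_mult[OF p has_pval_prime_power[OF p q False, of "e q"] IH] insert.hyps by simp
  qed
qed

text \<open>A prime factor of the reduced denominator would divide the numerator too, because s also
  has a representation with denominator prime to it.\<close>

lemma in_pZ_all_primes_int:
  assumes "\<And>p. prime p \<Longrightarrow> in_pZ p 0 s"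
  obtains k where "s = rat_of_int k"
proof -
  obtain a b where ab: "b > 0" "s = rat_of_int a / rat_of_int b" "coprime a b"
    using quotient_of_div quotient_of_denom_pos quotient_of_coprime by (metis surj_pair)
  have "nat b = 1"
  proof (rule ccontr)
    assume "nat b \<noteq> 1"
    then obtain p where p: "prime p" "p dvd nat b" using prime_factor_nat by blast
    then have pb: "int p dvd b" using ab(1) by (metis int_dvd_int_iff int_nat_eq less_imp_le)
    obtain c d where cd: "d \<noteq> 0" "\<not> int p dvd d" "s = rat_of_int c / rat_of_int d"
      using assms[OF p(1)] unfolding in_pZ_def by auto
    have "rat_of_int (a * d) = rat_of_int (c * b)"
      using ab(1,2) cd(1,3) by (simp add: field_simps)
    then have "a * d = c * b" by (simp only: of_int_eq_iff)
    then have "int p dvd a * d" using pb by simp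
    then have "int p dvd a" using cd(2) p(1) by (simp add: prime_dvd_mult_iff)
    then have "is_unit (int p)" using pb ab(3) coprime_common_divisor by blast
    then show False using not_p_dvd_1[OF p(1)] by simp
  qed
  then have "b = 1" by simp
  then show ?thesis using that ab(2) by simp
qed

text \<open>Both s and its inverse are integers. In adelic terms, 1 is the only rational in
  \<open>units_U\<close>, so a rational orbit meets \<open>units_U\<close> at most once.\<close>

lemma has_pval_0_all_primes_1:
  assumes "\<And>p. prime p \<Longrightarrow> has_pval p 0 s" and "s > 0" shows "s = 1"
proof -
  obtain k where k: "s = rat_of_int k"
    using in_pZ_all_primes_int[of s] assms(1) has_pval_def by auto
  obtain l where l: "inverse s = rat_of_int l"
    using in_pZ_all_primes_int[of "inverse s"] assms(1) has_pval_def by auto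
  have "rat_of_int (k * l) = 1"
    unfolding of_int_mult k[symmetric] l[symmetric] using assms(2) by simp
  then have "k * l = 1" by (simp only: of_int_eq_1_iff)
  moreover have "k > 0" using k assms(2) by simp
  ultimately have "k = 1" by (simp add: zmult_eq_1_iff)
  then show ?thesis using k by simp
qed

lemma Zp_units_padic_val:
  "prime p \<Longrightarrow> x \<in> Zp_units p \<Longrightarrow> padic_val x = 0"
  using has_val_padic_val Zp_units_iff by blast

lemma finite_padic_val_nonzero:
  assumes "adele_invertible a" shows "finite {p \<in> primes_set. padic_val (fst a p) \<noteq> 0}"
proof (rule finite_subset)
  show "{p \<in> primes_set. padic_val (fst a p) \<noteq> 0} \<subseteq> {p \<in> primes_set. fst a p \<notin> Zp_units p}"
    using Zp_units_padic_val by (auto simp: primes_set_def)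
  show "finite {p \<in> primes_set. fst a p \<notin> Zp_units p}"
    using assms by (simp add: adele_invertible_def)
qed

lemma has_pval_chi_factor:
  assumes a: "adele_invertible a" and p: "prime p"
  shows "has_pval p (- padic_val (fst a p)) (chi_factor a)"
proof -
  let ?T = "{q \<in> primes_set. padic_val (fst a q) \<noteq> 0}"
  have "has_pval p (if p \<in> ?T then - padic_val (fst a p) else 0) (\<Prod>q\<in>?T. rat_of_nat q powi - padic_val (fst a q))"
    by (rule has_pval_prod_prime_powers[OF p finite_padic_val_nonzero[OF a]]) blast
  moreover have "(if p \<in> ?T then - padic_val (fst a p) else 0) = - padic_val (fst a p)"
    using p by (simp add: primes_set_def)
  ultimately have 1: "has_pval p (- padic_val (fst a p)) (\<Prod>q\<in>?T. rat_of_nat q powi - padic_val (fst a q))"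
    by (simp only:)
  have "has_pval p 0 (rat_of_int (if snd a > 0 then 1 else - 1))"
    by (rule has_pval_unit[OF p]) (use not_p_dvd_1[OF p] in simp)
  from has_pval_mult[OF p this 1] show ?thesis
    unfolding chi_factor_def by (simp only: of_int_1 of_int_minus if_distrib[of rat_of_int] add_0)
qed

lemma chi_factor_sign:
  assumes "snd a \<noteq> 0" shows "real_of_rat (chi_factor a) * snd a > 0"
proof -
  have pos: "(\<Prod>p\<in>{p \<in> primes_set. padic_val (fst a p) \<noteq> 0}. rat_of_nat p powi - padic_val (fst a p)) > 0"
    by (intro prod_pos zero_less_power_int) (auto simp: primes_set_def prime_gt_0_nat)
  show ?thesis
  proof (cases "snd a > 0")
    case True
    then show ?thesis using pos by (simp add: chi_factor_def)
  next
    case False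
    then have "snd a < 0" using assms by simp
    moreover have "chi_factor a < 0" using False pos by (simp add: chi_factor_def)
    ultimately show ?thesis by (simp add: mult_neg_neg)
  qed
qed

section \<open>The map chi on rational multiples of units\<close>

lemma adele_scale_chi_factor_units:
  assumes a: "a \<in> adeles" and inv: "adele_invertible a"
  shows "adele_scale (chi_factor a) a \<in> units_U"
proof -
  have "padic_scale p (chi_factor a) (fst a p) \<in> Zp_units p" if "p \<in> primes_set" for p
  proof -
    have p: "prime p" using that by (simp add: primes_set_def)
    have "fst a p \<in> Qp p" using a that Af_Qp by (auto simp: adeles_def)
    moreover have "fst a p \<noteq> padic_zero" using inv that by (simp add: adele_invertible_def)
    ultimately have "has_val p (fst a p) (padic_val (fst a p))"
      by (rule has_val_padic_val_nonzero[OF p])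
    from has_val_scale[OF p this has_pval_chi_factor[OF inv p]] show ?thesis
      by (simp add: Zp_units_iff[OF p])
  qed
  then show ?thesis
    using chi_factor_sign[of a] inv by (simp add: adele_scale_def units_U_def adele_invertible_def)
qed

text \<open>The factor chosen by chi cancels all valuations and the sign of r, so its product with r
  is positive with valuation 0 at every prime, hence 1.\<close>

lemma chi_adele_scale:
  assumes c: "c \<in> units_U" and r: "r \<noteq> 0"
  shows "chi (adele_scale r c) = Inr c"
proof -
  define a where "a = adele_scale r c"
  have cA: "c \<in> adeles" using c units_U_subset_adeles by blast
  have snd_a: "snd a = real_of_rat r * snd c" by (simp add: a_def adele_scale_def)
  have c_pos: "snd c > 0" using c by (auto simp: units_U_def)
  have val: "has_val p (fst a p) w" if "has_pval p w r" "p \<in> primes_set" for p w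
  proof -
    have p: "prime p" using that by (simp add: primes_set_def)
    have "fst c p \<in> Zp_units p" using c that by (auto simp: units_U_def)
    then show ?thesis
      using has_val_scale[OF p _ that(1), of "fst c p" 0] that(2) by (simp add: Zp_units_iff[OF p] a_def adele_scale_def)
  qed
  have inv: "adele_invertible a"
    unfolding adele_invertible_def
  proof (intro conjI ballI)
    fix p assume "p \<in> primes_set"
    moreover from this obtain w where "has_pval p w r" using ex_has_pval[OF _ r] by (auto simp: primes_set_def)
    ultimately show "fst a p \<noteq> padic_zero" using val[of p w] by (auto simp: has_val_def primes_set_def padic_zero_def)
  next
    show "snd a \<noteq> 0" using r c_pos by (simp add: snd_a)
    have "{p \<in> primes_set. fst a p \<notin> Zp_units p} \<subseteq> {p \<in> primes_set. \<not> has_pval p 0 r}"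
      using val Zp_units_iff by (auto simp: primes_set_def)
    then show "finite {p \<in> primes_set. fst a p \<notin> Zp_units p}"
      using finite_pval_nonzero[OF r] by (rule finite_subset)
  qed
  have "chi_factor a * r = 1"
  proof (rule has_pval_0_all_primes_1)
    fix p :: nat assume p: "prime p"
    obtain w where w: "has_pval p w r" using ex_has_pval[OF p r] by blast
    then have "padic_val (fst a p) = w"
      using val[OF w] has_val_padic_val[OF p] p by (simp add: primes_set_def)
    then show "has_pval p 0 (chi_factor a * r)"
      using has_pval_mult[OF p has_pval_chi_factor[OF inv p] w] by simp
  next
    have "real_of_rat (chi_factor a * r) * snd c > 0"
      using chi_factor_sign[of a] r c_pos by (simp add: snd_a of_rat_mult mult.assoc)
    then show "chi_factor a * r > 0" using c_pos by (simp add: zero_less_mult_iff)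
  qed
  then have "adele_scale (chi_factor a) a = c"
    unfolding a_def by (simp add: adele_scale_scale[OF cA] adele_scale_1[OF cA])
  then show ?thesis using chi_invertible[OF inv] by (simp add: a_def)
qed

lemma chi_units: "c \<in> units_U \<Longrightarrow> chi c = Inr c"
  using chi_adele_scale[of c 1] adele_scale_1[of c] units_U_subset_adeles by auto

lemma chi_adeles_subset: "chi ` adeles \<subseteq> chi_target"
proof
  fix x assume "x \<in> chi ` adeles"
  then obtain a where a: "a \<in> adeles" "x = chi a" by blast
  show "x \<in> chi_target"
  proof (cases "adele_invertible a")
    case True
    then show ?thesis
      using adele_scale_chi_factor_units[OF a(1) True] by (simp add: a(2) chi_invertible chi_target_def)
  next
    case False
    then show ?thesis using zero_places_subset by (simp add: a(2) chi_not_invertible chi_target_def)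
  qed
qed

text \<open>In one direction \<open>chi_factor a\<close> is the required rational; in the other, a
  is recovered from its scaled unit by the inverse of r.\<close>

lemma chi_preimage_units:
  assumes D: "D \<subseteq> units_U"
  shows "{a \<in> adeles. chi a \<in> Inr ` D} = (\<Union>r\<in>{r. r \<noteq> 0}. {a \<in> adeles. adele_scale r a \<in> D})"
proof (intro set_eqI iffI)
  fix a assume "a \<in> {a \<in> adeles. chi a \<in> Inr ` D}"
  then have a: "a \<in> adeles" "chi a \<in> Inr ` D" by auto
  have inv: "adele_invertible a"
  proof (rule ccontr)
    assume "\<not> adele_invertible a"
    then show False using a(2) chi_not_invertible[of a] by auto
  qed
  then have "adele_scale (chi_factor a) a \<in> D" using a(2) by (auto simp: chi_invertible)
  moreover have "chi_factor a \<noteq> 0" using chi_factor_sign[of a] inv by (auto simp: adele_invertible_def)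
  ultimately show "a \<in> (\<Union>r\<in>{r. r \<noteq> 0}. {a \<in> adeles. adele_scale r a \<in> D})" using a(1) by blast
next
  fix a assume "a \<in> (\<Union>r\<in>{r. r \<noteq> 0}. {a \<in> adeles. adele_scale r a \<in> D})"
  then obtain r where r: "r \<noteq> 0" "a \<in> adeles" "adele_scale r a \<in> D" by blast
  have "a = adele_scale (inverse r) (adele_scale r a)"
    using r(1,2) by (simp add: adele_scale_scale adele_scale_1)
  moreover have "chi (adele_scale (inverse r) (adele_scale r a)) = Inr (adele_scale r a)"
    using r D by (intro chi_adele_scale) auto
  ultimately show "a \<in> {a \<in> adeles. chi a \<in> Inr ` D}" using r by auto
qed

text \<open>Near a given adele the denominators are bounded, so only finitely many rationals of absolute
  value bounded from below can scale a nearby adele into the units: they are of the form P / k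
  with P fixed and k a nonzero integer of bounded size.\<close>
lemma locally_finite_scalings:
  assumes a: "a \<in> adeles" and \<epsilon>: "\<epsilon> > 0"
  obtains N Q where "openin adele_top N" "a \<in> N" "finite Q"
    "\<And>b r. b \<in> N \<Longrightarrow> r \<noteq> 0 \<Longrightarrow> adele_scale r b \<in> units_U \<Longrightarrow> \<epsilon> \<le> snd (adele_scale r b) \<Longrightarrow> r \<in> Q"
proof -
  have a': "fst a \<in> Af" using a by (auto simp: adeles_def)
  define S where "S = {p \<in> primes_set. fst a p \<notin> Zp p}"
  have S: "finite S" "S \<subseteq> primes_set" using a' unfolding S_def Af_def by blast+
  \<comment> \<open>\<open>l p\<close> bounds the order of the pole of a at p.\<close>
  have "\<forall>p\<in>S. \<exists>l::nat. \<forall>k. k < - int l \<longrightarrow> fst a p k = 0"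
  proof
    fix p assume "p \<in> S"
    then have "fst a p \<in> Qp p" using S(2) Af_Qp[OF a'] by blast
    then obtain M where "\<forall>k<M. fst a p k = 0" unfolding Qp_def by blast
    then show "\<exists>l::nat. \<forall>k. k < - int l \<longrightarrow> fst a p k = 0" by (intro exI[of _ "nat (- M)"]) simp
  qed
  from bchoice[OF this] obtain l :: "nat \<Rightarrow> nat" where l: "\<forall>p\<in>S. \<forall>k. k < - int (l p) \<longrightarrow> fst a p k = 0" by blast
  \<comment> \<open>At places of S the digits at negative positions are frozen, so adeles in N have
    the same poles as a; elsewhere they are integral.\<close>
  define N where "N = {b \<in> Af. (\<forall>p\<in>S. b p \<in> {y \<in> Qp p. \<forall>k<0. y k = fst a p k}) \<and> (\<forall>p\<in>primes_set - S. b p \<in> Zp p)}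
      \<times> {y. \<bar>y - snd a\<bar> < 1}"
  define P where "P = (\<Prod>p\<in>S. int p ^ l p)"
  have P0: "P > 0" unfolding P_def using S(2) by (intro prod_pos) (auto simp: primes_set_def prime_gt_0_nat)
  \<comment> \<open>If r = P/k brings b into the units with real component at least \<epsilon>, then
    |k| \<epsilon> is at most |snd b| P, and |snd b| < |snd a| + 1 on N.\<close>
  define K where "K = \<lceil>(\<bar>snd a\<bar> + 1) / \<epsilon> * real_of_int P\<rceil>"
  \<comment> \<open>The index k = 0 merely adds the value 0 of division by zero to a finite
    set.\<close>
  define Q where "Q = (\<lambda>k. rat_of_int P / rat_of_int k) ` {- K..K}"
  show ?thesis
  proof (rule that)
    show "finite Q" by (simp add: Q_def)
    have "{y. \<bar>y - snd a\<bar> < 1} = ball (snd a) 1" by (auto simp: ball_def dist_real_def)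
    then have "open {y. \<bar>y - snd a\<bar> < 1}" by simp
    moreover have "openin Af_top {b \<in> Af. (\<forall>p\<in>S. b p \<in> {y \<in> Qp p. \<forall>k<0. y k = fst a p k}) \<and> (\<forall>p\<in>primes_set - S. b p \<in> Zp p)}"
      using S Af_Qp[OF a'] by (intro openin_Af_basic Qp_ball_openin) auto
    ultimately show "openin adele_top N"
      unfolding N_def adele_top_def openin_prod_Times_iff by simp
    show "a \<in> N"
      using a' S(2) Af_Qp[OF a'] unfolding N_def by (cases a) (auto simp: S_def)
    fix b r assume b: "b \<in> N" and r: "r \<noteq> 0" and U: "adele_scale r b \<in> units_U" and ge: "\<epsilon> \<le> snd (adele_scale r b)"
    define s where "s = inverse r"
    have s0: "s \<noteq> 0" using r by (simp add: s_def)
    have b_Af: "fst b \<in> Af" and b_inf: "\<bar>snd b - snd a\<bar> < 1" using b by (auto simp: N_def)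
    \<comment> \<open>b is s times the scaled unit, so its valuation at p is that of s. The bound on
      the poles of b thus bounds the denominator of s, and P clears it.\<close>
    have val: "has_val p (fst b p) w" if "has_pval p w s" "p \<in> primes_set" for p w
    proof -
      have p: "prime p" using that by (simp add: primes_set_def)
      have "fst (adele_scale r b) p \<in> Zp_units p"
        using U that(2) by (auto simp: units_U_def)
      then have "has_val p (padic_scale p r (fst b p)) 0"
        using that(2) by (simp add: adele_scale_def Zp_units_iff[OF p])
      from has_val_scale[OF p this that(1)] show ?thesis
        using padic_scale_scale[OF p Af_Qp[OF b_Af that(2)]] padic_scale_1[OF p Af_Qp[OF b_Af that(2)]] r
        by (simp add: s_def)
    qed
    have int: "in_pZ p 0 (s * rat_of_int P)" if p: "prime p" for p
    proof -
      obtain w where w: "has_pval p w s" using ex_has_pval[OF p s0] by blast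
      have pp: "p \<in> primes_set" using p by (simp add: primes_set_def)
      have bw: "fst b p w \<noteq> 0" using val[OF w pp] by (simp add: has_val_def[OF p])
      show ?thesis
      proof (cases "p \<in> S")
        case True
        have "fst b p k = 0" if "k < - int (l p)" for k
          using b True that l by (auto simp: N_def)
        then have "- int (l p) \<le> w" using bw by (meson not_less)
        then have 1: "in_pZ p (- int (l p)) s" using in_pZ_mono[OF p, of w s] w by (simp add: has_pval_def[OF p])
        have "P = int p ^ l p * (\<Prod>q\<in>S - {p}. int q ^ l q)"
          unfolding P_def using prod.remove[OF S(1) True] by simp
        then have "rat_of_int P = rat_of_nat p powi int (l p) * rat_of_int (\<Prod>q\<in>S - {p}. int q ^ l q)"
          by (simp only: of_int_mult of_int_power power_int_of_nat of_int_of_nat_eq)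
        then have "in_pZ p (int (l p) + 0) (rat_of_int P)"
          using in_pZ_mult[OF p in_pZ_powi[OF p] in_pZ_of_int[OF p]] by metis
        from in_pZ_mult[OF p 1 this] show ?thesis by simp
      next
        case False
        have "fst b p k = 0" if "k < 0" for k
          using b False that pp by (auto simp: N_def Zp_def)
        then have "0 \<le> w" using bw by (meson not_less)
        then have "in_pZ p 0 s" using in_pZ_mono[OF p, of w s] w by (simp add: has_pval_def[OF p])
        from in_pZ_mult[OF p this in_pZ_of_int[OF p]] show ?thesis by simp
      qed
    qed
    obtain k where k: "s * rat_of_int P = rat_of_int k" using in_pZ_all_primes_int[OF int] .
    have "rat_of_int k \<noteq> 0" unfolding k[symmetric] using s0 P0 by simp
    then have rk: "r = rat_of_int P / rat_of_int k"
      unfolding k[symmetric] using r P0 by (simp add: s_def divide_inverse)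
    have c: "snd (adele_scale r b) = real_of_rat r * snd b" by (simp add: adele_scale_def)
    have "real_of_int k = real_of_rat (rat_of_int k)" by simp
    also have "\<dots> = real_of_rat s * real_of_int P" by (simp only: k[symmetric] of_rat_mult of_rat_of_int_eq)
    finally have "\<bar>real_of_int k\<bar> * \<epsilon> = \<bar>real_of_rat s\<bar> * \<epsilon> * real_of_int P"
      using P0 by (simp add: abs_mult)
    also have "\<dots> \<le> \<bar>real_of_rat s\<bar> * (real_of_rat r * snd b) * real_of_int P"
      using ge P0 c by (intro mult_right_mono mult_left_mono) auto
    also have "\<dots> \<le> \<bar>real_of_rat s\<bar> * \<bar>real_of_rat r * snd b\<bar> * real_of_int P"
      using P0 by (intro mult_right_mono mult_left_mono abs_ge_self) auto
    also have "\<dots> = \<bar>real_of_rat s * (real_of_rat r * snd b)\<bar> * real_of_int P"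
      by (simp only: abs_mult)
    also have "real_of_rat s * (real_of_rat r * snd b) = snd b"
      using r by (simp add: s_def of_rat_inverse)
    also have "\<bar>snd b\<bar> * real_of_int P \<le> (\<bar>snd a\<bar> + 1) * real_of_int P"
      using b_inf P0 by (intro mult_right_mono) auto
    finally have "\<bar>real_of_int k\<bar> \<le> (\<bar>snd a\<bar> + 1) / \<epsilon> * real_of_int P"
      using \<epsilon> by (simp add: field_simps)
    also have "\<dots> \<le> real_of_int K" unfolding K_def by (rule le_of_int_ceiling)
    finally have "k \<in> {- K..K}" by (simp flip: of_int_abs) linarith
    then show "r \<in> Q" unfolding Q_def rk by (rule imageI)
  qed
qed

lemma closedin_chi_preimage_units:
  assumes D: "closedin adele_top D" "D \<subseteq> units_U" and \<epsilon>: "\<epsilon> > 0" and ge: "\<And>c. c \<in> D \<Longrightarrow> \<epsilon> \<le> snd c"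
  shows "closedin adele_top {a \<in> adeles. chi a \<in> Inr ` D}"
proof -
  define E where "E r = {a \<in> adeles. adele_scale r a \<in> D}" for r
  have "closedin adele_top (\<Union> (E ` {r. r \<noteq> 0}))"
  proof (rule closedin_locally_finite_Union)
    fix T assume "T \<in> E ` {r. r \<noteq> 0}"
    then obtain r where "r \<noteq> 0" "T = E r" by blast
    then show "closedin adele_top T"
      using closedin_continuous_map_preimage[OF continuous_map_adele_scale D(1)]
      by (simp add: E_def topspace_adele_top)
  next
    show "locally_finite_in adele_top (E ` {r. r \<noteq> 0})"
      unfolding locally_finite_in_def topspace_adele_top
    proof (intro conjI ballI)
      show "\<Union> (E ` {r. r \<noteq> 0}) \<subseteq> adeles" by (auto simp: E_def)
      fix a assume "a \<in> adeles"
      then obtain N Q where N: "openin adele_top N" "a \<in> N" and Q: "finite Q"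
        "\<And>b r. b \<in> N \<Longrightarrow> r \<noteq> 0 \<Longrightarrow> adele_scale r b \<in> units_U \<Longrightarrow> \<epsilon> \<le> snd (adele_scale r b) \<Longrightarrow> r \<in> Q"
        using locally_finite_scalings[OF _ \<epsilon>] by metis
      have "{U \<in> E ` {r. r \<noteq> 0}. U \<inter> N \<noteq> {}} \<subseteq> E ` Q"
      proof
        fix U assume "U \<in> {U \<in> E ` {r. r \<noteq> 0}. U \<inter> N \<noteq> {}}"
        then obtain r b where r: "r \<noteq> 0" "U = E r" "b \<in> E r" "b \<in> N" by blast
        then have "adele_scale r b \<in> D" by (simp add: E_def)
        then have "r \<in> Q" using Q(2)[OF r(4,1)] D(2) ge by blast
        then show "U \<in> E ` Q" using r(2) by blast
      qed
      then have "finite {U \<in> E ` {r. r \<noteq> 0}. U \<inter> N \<noteq> {}}" using Q(1) by (meson finite_imageI finite_subset)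
      then show "\<exists>V. openin adele_top V \<and> a \<in> V \<and> finite {U \<in> E ` {r. r \<noteq> 0}. U \<inter> V \<noteq> {}}"
        using N by blast
    qed
  qed
  then show ?thesis unfolding chi_preimage_units[OF D(2)] E_def .
qed


section \<open>Approximation by non-invertible adeles\<close>

text \<open>The expansion of p^M, the same sequence for every p. It serves as a nonzero number
  indistinguishable from 0 below position M and, for M = 1, as an integral nonunit.\<close>

definition padic_pow :: "int \<Rightarrow> padic" where
  "padic_pow M = (\<lambda>k. if k = M then 1 else 0)"

lemma padic_pow_Qp: "prime p \<Longrightarrow> padic_pow M \<in> Qp p"
  using prime_gt_1_nat[of p] by (auto simp: padic_pow_def Qp_def intro!: exI[of _ M])

lemma padic_pow_nonzero: "padic_pow M \<noteq> padic_zero"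
  by (auto simp: padic_pow_def padic_zero_def fun_eq_iff)

lemma padic_pow_Zp: "prime p \<Longrightarrow> 0 \<le> M \<Longrightarrow> padic_pow M \<in> Zp p"
  using padic_pow_Qp[of p M] by (auto simp: Zp_def) (auto simp: padic_pow_def)

lemma padic_zero_Zp: "prime p \<Longrightarrow> padic_zero \<in> Zp p"
  using padic_zero_Qp[of p] by (auto simp: Zp_def) (auto simp: padic_zero_def)

text \<open>There are infinitely many primes, so infinitely many lie outside S.\<close>

lemma not_invertible_infinite_nonunits:
  assumes "finite S" "\<And>p. p \<in> primes_set - S \<Longrightarrow> fst b p \<notin> Zp_units p"
  shows "\<not> adele_invertible b"
proof
  assume "adele_invertible b"
  then have "finite {p \<in> primes_set. fst b p \<notin> Zp_units p}" by (simp add: adele_invertible_def)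
  moreover have "primes_set \<subseteq> S \<union> {p \<in> primes_set. fst b p \<notin> Zp_units p}" using assms(2) by blast
  ultimately have "finite primes_set" using assms(1) by (meson finite_UnI finite_subset)
  then show False using primes_infinite by (simp add: primes_set_def)
qed

lemma ex_chi_Inl_nearby:
  assumes W: "openin adele_top W" and a: "a \<in> W"
  obtains G where "finite G" "G \<subseteq> places" "zero_places a \<inter> G = {}"
    "\<And>T. T \<subseteq> places \<Longrightarrow> T \<inter> G = {} \<Longrightarrow> \<exists>b\<in>W. chi b = Inl T"
proof -
  obtain S M \<delta> where S: "finite S" "S \<subseteq> primes_set" and M: "0 \<le> M"
    and aZ: "\<forall>p\<in>primes_set - S. fst a p \<in> Zp p" and \<delta>: "\<delta> > 0"
    and nbhd: "\<And>b. fst b \<in> Af_nbhd (fst a) S M \<Longrightarrow> \<bar>snd b - snd a\<bar> < \<delta> \<Longrightarrow> b \<in> W"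
    using openin_adele_nbhd[OF W a] by metis
  have "a \<in> adeles" using openin_subset[OF W] a by (auto simp: topspace_adele_top)
  then have a': "fst a \<in> Af" by (auto simp: adeles_def)
  \<comment> \<open>Among the places of S and the infinite place, those where a does not vanish:
    there b will keep the component of a, so T has to avoid them.\<close>
  define G where "G = ((Some ` S) \<union> {None}) - zero_places a"
  show ?thesis
  proof (rule that)
    show "finite G" "zero_places a \<inter> G = {}" using S(1) by (auto simp: G_def)
    show "G \<subseteq> places" using S(2) by (auto simp: G_def places_def)
    fix T assume T: "T \<subseteq> places" "T \<inter> G = {}"
    \<comment> \<open>Where a vanishes at p in S and b must not, p^M agrees with 0 to the required
      precision. Outside S the entries are 0 or p, integral but never units, so b is not
      invertible.\<close>
    define x where "x = (\<lambda>p\<in>primes_set. if Some p \<in> T then padic_zero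
      else if p \<in> S \<and> fst a p \<noteq> padic_zero then fst a p
      else if p \<in> S then padic_pow M else padic_pow 1)"
    \<comment> \<open>At the infinite place \<delta>/2 takes the part of p^M.\<close>
    define b :: adele where "b = (x, if None \<in> T then 0 else if snd a \<noteq> 0 then snd a else \<delta> / 2)"
    have xQ: "x p \<in> Qp p" if "p \<in> primes_set" for p
      using that padic_zero_Qp padic_pow_Qp Af_Qp[OF a' that] by (simp add: x_def primes_set_def)
    have xZ: "x p \<in> Zp p" if "p \<in> primes_set - S" for p
      using that padic_zero_Zp padic_pow_Zp by (simp add: x_def primes_set_def)
    have "{p \<in> primes_set. x p \<notin> Zp p} \<subseteq> S" using xZ by blast
    then have "finite {p \<in> primes_set. x p \<notin> Zp p}" using S(1) by (rule finite_subset)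
    moreover have "x \<in> (\<Pi>\<^sub>E p\<in>primes_set. Qp p)"
      using xQ by (intro PiE_I) (simp_all add: x_def)
    ultimately have "x \<in> Af" unfolding Af_def by blast
    moreover have "x p k = fst a p k" if "p \<in> S" "k < M" for p k
    proof (cases "Some p \<in> zero_places a")
      case True
      then have "fst a p = padic_zero" by (simp add: Some_in_zero_places)
      then show ?thesis using that S(2) by (auto simp: x_def padic_zero_def padic_pow_def)
    next
      case False
      then have "Some p \<in> G" using that(1) by (simp add: G_def)
      then have "Some p \<notin> T" using T(2) by blast
      then show ?thesis using False that S(2) by (auto simp: x_def Some_in_zero_places)
    qed
    ultimately have "x \<in> Af_nbhd (fst a) S M" using xZ by (simp add: Af_nbhd_def)
    moreover have "\<bar>snd b - snd a\<bar> < \<delta>"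
    proof (cases "snd a = 0")
      case True
      then show ?thesis using \<delta> by (simp add: b_def)
    next
      case False
      then have "None \<in> G" by (simp add: G_def None_in_zero_places)
      then have "None \<notin> T" using T(2) by blast
      then show ?thesis using False \<delta> by (simp add: b_def)
    qed
    ultimately have "b \<in> W" by (intro nbhd) (simp_all add: b_def)
    moreover have "chi b = Inl T"
    proof -
      have "x p \<notin> Zp_units p" if "p \<in> primes_set - S" for p
        using that by (simp add: x_def Zp_units_def padic_zero_def padic_pow_def)
      then have "\<not> adele_invertible b"
        by (intro not_invertible_infinite_nonunits[OF S(1)]) (simp add: b_def)
      moreover have "zero_places b = T"
      proof (rule set_eqI)
        fix v show "v \<in> zero_places b \<longleftrightarrow> v \<in> T"
        proof (cases v)
          case None
          then show ?thesis using \<delta> by (simp add: None_in_zero_places b_def)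
        next
          case (Some p)
          show ?thesis
          proof (cases "p \<in> primes_set")
            case True
            then show ?thesis
              using padic_pow_nonzero by (simp add: Some Some_in_zero_places b_def x_def)
          next
            case False
            then show ?thesis using T(1) by (auto simp: Some Some_in_zero_places places_def)
          qed
        qed
      qed
      ultimately show ?thesis by (simp add: chi_not_invertible)
    qed
    ultimately show "\<exists>b\<in>W. chi b = Inl T" by blast
  qed
qed

lemma chi_image_adeles: "chi ` adeles = chi_target"
proof
  show "chi ` adeles \<subseteq> chi_target" by (rule chi_adeles_subset)
  \<comment> \<open>The zero adele vanishes at all places, so the set G to be avoided near it is
    empty and every T occurs.\<close>
  define z :: adele where "z = ((\<lambda>p\<in>primes_set. padic_zero), 0)"
  have "(\<lambda>p\<in>primes_set. padic_zero) \<in> (\<Pi>\<^sub>E p\<in>primes_set. Qp p)"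
    using padic_zero_Qp by (simp add: primes_set_def)
  moreover have "{p \<in> primes_set. (\<lambda>p\<in>primes_set. padic_zero) p \<notin> Zp p} = {}"
    using padic_zero_Zp by (simp add: primes_set_def)
  then have "finite {p \<in> primes_set. (\<lambda>p\<in>primes_set. padic_zero) p \<notin> Zp p}" by (simp only: finite.emptyI)
  ultimately have "(\<lambda>p\<in>primes_set. padic_zero) \<in> Af" unfolding Af_def by blast
  then have z: "z \<in> adeles" by (simp add: z_def adeles_def)
  have zp: "zero_places z = places"
    by (auto simp: zero_places_def z_def places_def)
  have "openin adele_top adeles" using openin_topspace[of adele_top] by (simp add: topspace_adele_top)
  from ex_chi_Inl_nearby[OF this z] obtain G where "G \<subseteq> places" "places \<inter> G = {}"
    "\<And>T. T \<subseteq> places \<Longrightarrow> T \<inter> G = {} \<Longrightarrow> \<exists>b\<in>adeles. chi b = Inl T"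
    unfolding zp by metis
  then have Inl: "Inl T \<in> chi ` adeles" if "T \<subseteq> places" for T
    using that by (metis Int_absorb2 image_eqI inf_bot_right inf_commute)
  have Inr: "Inr c \<in> chi ` adeles" if "c \<in> units_U" for c
    using that chi_units[OF that] units_U_subset_adeles by (metis image_eqI subsetD)
  show "chi_target \<subseteq> chi ` adeles"
    using Inl Inr by (auto simp: chi_target_def)
qed

section \<open>Approximation by integral multiples of units\<close>

lemma in_pZ_cong:
  assumes p: "prime p" and "[A = B] (mod p ^ m)"
  shows "in_pZ p (int m) (rat_of_nat A - rat_of_nat B)"
proof -
  have "[int A = int B] (mod int p ^ m)" using assms(2) cong_int_iff[of A B "p ^ m"] by simp
  then obtain z where "int A - int B = int p ^ m * z" by (auto simp: cong_iff_dvd_diff)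
  then have "rat_of_int (int A - int B) = rat_of_int (int p ^ m * z)" by (rule arg_cong)
  then have "rat_of_nat A - rat_of_nat B = rat_of_nat p powi int m * rat_of_int z"
    by (simp only: of_int_mult of_int_power power_int_of_nat of_int_of_nat_eq of_int_diff)
  then show ?thesis using in_pZ_mult[OF p in_pZ_powi[OF p] in_pZ_of_int[OF p], of "int m" z] by simp
qed

lemma padic_trunc_Zp_nat:
  assumes "x \<in> Zp p" obtains X where "padic_trunc p x m = rat_of_nat X"
proof
  have "padic_trunc p x m = (\<Sum>k\<in>{k. k < m \<and> x k \<noteq> 0}. rat_of_nat (x k * p ^ nat k))"
    unfolding padic_trunc_def
  proof (rule sum.cong)
    fix k assume "k \<in> {k. k < m \<and> x k \<noteq> 0}"
    then have "0 \<le> k" using assms by (auto simp: Zp_def not_less[symmetric])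
    then show "rat_of_nat (x k) * rat_of_nat p powi k = rat_of_nat (x k * p ^ nat k)"
      by (simp add: power_int_def)
  qed simp
  then show "padic_trunc p x m = rat_of_nat (\<Sum>k\<in>{k. k < m \<and> x k \<noteq> 0}. x k * p ^ nat k)" by simp
qed

text \<open>Modulo p the truncation is its digit at position 0, which is nonzero and below
  p.\<close>

lemma padic_trunc_unit_nat:
  assumes p: "prime p" and x: "x \<in> Zp_units p" and m: "1 \<le> m"
  obtains X where "padic_trunc p x m = rat_of_nat X" "coprime X p"
proof -
  obtain X where X: "padic_trunc p x m = rat_of_nat X" using padic_trunc_Zp_nat[OF Zp_units_Zp[OF x]] .
  have xQ: "x \<in> Qp p" by (rule Zp_units_Qp[OF x])
  have "\<not> p dvd X"
  proof
    assume "p dvd X"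
    then have "[X = 0] (mod p ^ 1)" by (simp add: cong_0_iff)
    from in_pZ_cong[OF p this] have 1: "in_pZ p 1 (padic_trunc p x m)" by (simp add: X)
    have "padic_trunc p x 0 = 0" using x by (intro padic_trunc_eq_0[OF p]) (auto simp: Zp_units_def Zp_def)
    then have "padic_trunc p x 1 = rat_of_int (int (x 0)) * rat_of_nat p powi 0"
      using padic_trunc_step[OF p xQ, of 0] by simp
    moreover have "in_pZ p 1 (padic_trunc p x m - (padic_trunc p x m - padic_trunc p x 1))"
      by (intro in_pZ_diff[OF p] in_pZ_trunc_diff[OF p] xQ m 1)
    ultimately have "in_pZ p (0 + 1) (rat_of_int (int (x 0)) * rat_of_nat p powi 0)" by simp
    then have "int p dvd int (x 0)" by (rule in_pZ_Suc_imp_dvd[OF p])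
    then have "p dvd x 0" by simp
    moreover have "0 < x 0" "x 0 < p" using x by (auto simp: Zp_units_def Zp_def Qp_def)
    ultimately show False using dvd_imp_le by force
  qed
  then have "coprime p X" by (rule prime_imp_coprime[OF p])
  then have "coprime X p" by (simp only: coprime_commute)
  then show ?thesis using that X by blast
qed

text \<open>u is y/x modulo p^m, computed from the truncations of both. Admitting every n congruent
  to u prepares the use of the Chinese remainder theorem over several primes.\<close>

lemma unit_multiple_approx:
  assumes p: "prime p" and x: "x \<in> Zp_units p" and y: "y \<in> Zp p" and m: "1 \<le> m"
  obtains u where "\<And>n k. [n = u] (mod p ^ m) \<Longrightarrow> k < int m \<Longrightarrow> padic_scale p (rat_of_nat n) x k = y k"
proof -
  obtain X where X: "padic_trunc p x (int m) = rat_of_nat X" "coprime X p"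
    using padic_trunc_unit_nat[OF p x, of "int m"] m by auto
  obtain Y where Y: "padic_trunc p y (int m) = rat_of_nat Y" using padic_trunc_Zp_nat[OF y] .
  have "coprime X (p ^ m)" using X(2) by simp
  then obtain z where z: "[X * z = Suc 0] (mod p ^ m)" using cong_solve_coprime_nat by blast
  have xQ: "x \<in> Qp p" by (rule Zp_units_Qp[OF x])
  have "padic_scale p (rat_of_nat n) x k = y k" if n: "[n = z * Y] (mod p ^ m)" and k: "k < int m" for n k
  proof -
    have "[n * X = (z * Y) * X] (mod p ^ m)" using n by (rule cong_scalar_right)
    moreover have "[(X * z) * Y = Suc 0 * Y] (mod p ^ m)" using z by (rule cong_scalar_right)
    ultimately have "[n * X = Y] (mod p ^ m)"
      by (metis cong_trans mult.assoc mult.commute mult_Suc mult_0 add_0_right)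
    from in_pZ_cong[OF p this] have 1: "in_pZ p (int m) (rat_of_nat n * padic_trunc p x (int m) - padic_trunc p y (int m))"
      by (simp add: X Y)
    have "in_pZ p 0 (rat_of_nat n)" using in_pZ_of_int[OF p, of "int n"] by simp
    from is_scale_trunc[OF p xQ this is_scale_padic_scale[OF p xQ], of "int m"]
    have "in_pZ p (int m) (padic_trunc p (padic_scale p (rat_of_nat n) x) (int m) - rat_of_nat n * padic_trunc p x (int m))"
      by simp
    from in_pZ_add[OF p this 1]
    have "in_pZ p (int m) (padic_trunc p (padic_scale p (rat_of_nat n) x) (int m) - padic_trunc p y (int m))"
      by simp
    then show ?thesis
      using digits_eq_iff[OF p padic_scale_Qp[OF p xQ] Zp_Qp[OF y]] k by blast
  qed
  then show ?thesis using that by blast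
qed

text \<open>The multiplier is found by the Chinese remainder theorem modulo P, the product of the
  prescribed prime powers; shifting it by multiples of P moves the real component in steps of
  P times the real component of c, hence c is taken with small real component.\<close>
lemma ex_multiple_nearby:
  assumes C: "C \<subseteq> units_U" and 0: "0 \<in> closure (snd ` C)"
    and a: "\<And>p. p \<in> primes_set \<Longrightarrow> fst a p \<in> Zp p" "snd a = 1"
    and W: "openin adele_top W" "a \<in> W"
  shows "\<exists>c\<in>C. \<exists>r. r \<noteq> 0 \<and> adele_scale r c \<in> W"
proof -
  obtain S M \<delta> where S: "finite S" "S \<subseteq> primes_set" and M: "0 \<le> M" and \<delta>: "\<delta> > 0"
    and nbhd: "\<And>b. fst b \<in> Af_nbhd (fst a) S M \<Longrightarrow> \<bar>snd b - snd a\<bar> < \<delta> \<Longrightarrow> b \<in> W"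
    using openin_adele_nbhd[OF W] by metis
  \<comment> \<open>The extra 1 ensures \<open>1 \<le> m\<close>, as
    \<open>unit_multiple_approx\<close> requires, also for M = 0.\<close>
  define m where "m = nat M + 1"
  define P where "P = (\<Prod>p\<in>S. p ^ m)"
  have P: "P > 0" unfolding P_def using S(2) by (intro prod_pos) (auto simp: primes_set_def prime_gt_0_nat)
  have "min \<delta> 1 / real P > 0" using P \<delta> by simp
  then obtain c where c: "c \<in> C" "\<bar>snd c\<bar> < min \<delta> 1 / real P"
    using 0 by (force simp: closure_approachable dist_real_def)
  have cU: "c \<in> units_U" using c(1) C by blast
  then have c_pos: "snd c > 0" by (auto simp: units_U_def)
  \<comment> \<open>The change of the real component when n grows by P: below \<delta> for the
    approximation, below 1 so that n cannot be 0.\<close>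
  define h where "h = real P * snd c"
  have h: "0 < h" "h < \<delta>" "h < 1" using c(2) c_pos P by (auto simp: h_def field_simps)
  have "\<forall>p\<in>S. \<exists>u. \<forall>n k. [n = u] (mod p ^ m) \<longrightarrow> k < int m \<longrightarrow> padic_scale p (rat_of_nat n) (fst c p) k = fst a p k"
  proof
    fix p assume "p \<in> S"
    then have p: "prime p" "p \<in> primes_set" using S(2) by (auto simp: primes_set_def)
    then have "fst c p \<in> Zp_units p" using cU by (auto simp: units_U_def)
    then show "\<exists>u. \<forall>n k. [n = u] (mod p ^ m) \<longrightarrow> k < int m \<longrightarrow> padic_scale p (rat_of_nat n) (fst c p) k = fst a p k"
      using unit_multiple_approx[OF p(1) _ a(1)[OF p(2)], of "fst c p" m] by (metis le_add2 m_def)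
  qed
  from bchoice[OF this] obtain u where
    u: "\<forall>p\<in>S. \<forall>n k. [n = u p] (mod p ^ m) \<longrightarrow> k < int m \<longrightarrow> padic_scale p (rat_of_nat n) (fst c p) k = fst a p k" ..
  have "\<forall>p\<in>S. p ^ m \<noteq> 0"
  proof
    fix p assume "p \<in> S"
    then have "prime p" using S(2) by (auto simp: primes_set_def)
    then show "p ^ m \<noteq> 0" by simp
  qed
  moreover have "\<forall>p\<in>S. \<forall>q\<in>S. p \<noteq> q \<longrightarrow> coprime (p ^ m) (q ^ m)"
  proof (intro ballI impI)
    fix p q assume "p \<in> S" "q \<in> S" "p \<noteq> q"
    moreover from this have "prime p" "prime q" using S(2) by (auto simp: primes_set_def)
    ultimately have "coprime p q" using primes_coprime by blast
    then show "coprime (p ^ m) (q ^ m)" by simp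
  qed
  ultimately obtain n0 where n0: "n0 < P" "\<forall>p\<in>S. [n0 = u p] (mod p ^ m)"
    using chinese_remainder_unique_nat[OF S(1), of "\<lambda>p. p ^ m" u] unfolding P_def by blast
  \<comment> \<open>The largest number of steps from \<open>n0\<close> that keeps the real component
    at most 1.\<close>
  define t where "t = nat \<lfloor>(1 - real n0 * snd c) / h\<rfloor>"
  define n where "n = n0 + t * P"
  \<comment> \<open>The starting value lies below h < 1, so \<open>nat\<close> is applied to a
    nonnegative floor and cuts nothing off.\<close>
  have "real n0 * snd c < h" using n0(1) c_pos by (simp add: h_def)
  then have "(1 - real n0 * snd c) / h > 0" using h by simp
  then have t: "real t \<le> (1 - real n0 * snd c) / h" "(1 - real n0 * snd c) / h < real t + 1"
    unfolding t_def by linarith+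
  have "real n * snd c = real n0 * snd c + real t * h" by (simp add: n_def h_def algebra_simps)
  then have nc: "real n * snd c \<le> 1" "1 - h < real n * snd c"
    using t h(1) by (simp_all add: field_simps)
  then have n_pos: "n \<noteq> 0" using h by (intro notI) simp
  define b where "b = adele_scale (rat_of_nat n) c"
  have cA: "c \<in> adeles" using cU units_U_subset_adeles by blast
  have "fst b \<in> Af_nbhd (fst a) S M"
    unfolding Af_nbhd_def
  proof (intro CollectI conjI ballI allI impI)
    show "fst b \<in> Af" using adele_scale_adeles[OF cA, of "rat_of_nat n"]
      by (simp add: b_def adeles_def mem_Times_iff)
  next
    fix p k assume p: "p \<in> S" and k: "k < M"
    have "[n = n0] (mod p ^ m)"
    proof -
      have "p ^ m dvd P" unfolding P_def using p S(1) by (rule_tac dvd_prodI) auto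
      then have "[t * P = 0] (mod p ^ m)" by (simp add: cong_0_iff)
      then show ?thesis unfolding n_def by (simp only: cong_add_lcancel_0_nat)
    qed
    then have "[n = u p] (mod p ^ m)" using n0(2) p cong_trans by blast
    moreover have "k < int m" using k by (simp add: m_def)
    ultimately show "fst b p k = fst a p k"
      using u p S(2) by (auto simp: b_def adele_scale_def)
  next
    fix p assume "p \<in> primes_set - S"
    then have p: "prime p" "p \<in> primes_set" by (auto simp: primes_set_def)
    have "fst c p \<in> Zp_units p" using cU p by (auto simp: units_U_def)
    then have "fst c p \<in> Zp p" by (rule Zp_units_Zp)
    moreover have "in_pZ p 0 (rat_of_nat n)" using in_pZ_of_int[OF p(1), of "int n"] by simp
    ultimately show "fst b p \<in> Zp p"
      using padic_scale_Zp[OF p(1)] p(2) by (simp add: b_def adele_scale_def)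
  qed
  moreover have "\<bar>snd b - snd a\<bar> < \<delta>"
    using nc h(2) a(2) by (simp add: b_def adele_scale_def)
  ultimately have "b \<in> W" by (rule nbhd)
  then show ?thesis using c(1) n_pos unfolding b_def by (intro bexI[OF _ c(1)] exI[of _ "rat_of_nat n"]) simp
qed

section \<open>The power-cofinite topology\<close>

lemma topspace_pc_top: "topspace pc_top = Pow places"
proof
  show "topspace pc_top \<subseteq> Pow places" unfolding pc_top_def topology_generated_by_topspace by blast
  have "openin pc_top {T \<in> Pow places. T \<inter> {} = {}}"
    unfolding pc_top_def by (rule topology_generated_by_Basis) blast
  from openin_subset[OF this] show "Pow places \<subseteq> topspace pc_top" by auto
qed

lemma openin_pc_basic: "finite G \<Longrightarrow> G \<subseteq> places \<Longrightarrow> openin pc_top {T \<in> Pow places. T \<inter> G = {}}"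
  unfolding pc_top_def by (rule topology_generated_by_Basis) blast

text \<open>Avoiding G is inherited by subsets, and unions and intersections preserve this; hence
  every nonempty open set contains {}.\<close>

lemma openin_pc_down_closed:
  assumes "openin pc_top W" "T \<in> W" "T' \<subseteq> T" shows "T' \<in> W"
proof -
  have "generate_topology_on {{T \<in> Pow places. T \<inter> G = {}} | G. finite G \<and> G \<subseteq> places} W"
    using assms(1) unfolding pc_top_def by (rule openin_topology_generated_by)
  then have "\<forall>T T'. T \<in> W \<longrightarrow> T' \<subseteq> T \<longrightarrow> T' \<in> W"
  proof (induction rule: generate_topology_on.induct)
    case (UN K)
    show ?case
    proof (intro allI impI)
      fix T T' assume "T \<in> \<Union> K" and sub: "T' \<subseteq> T"
      then obtain V where V: "V \<in> K" "T \<in> V" by blast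
      have "T' \<in> V" using UN.IH[OF V(1)] V(2) sub by (elim allE[of _ T] allE[of _ T']) simp
      then show "T' \<in> \<Union> K" using V(1) by blast
    qed
  next
    case (Basis W)
    then obtain G where "W = {T \<in> Pow places. T \<inter> G = {}}" by blast
    then show ?case by auto
  next
    case (Int V W)
    then show ?case by (meson IntD1 IntD2 IntI)
  qed simp
  then show ?thesis using assms by blast
qed

text \<open>An open set around any T contains {} and therefore meets B. Contrapositively, the
  closure of a non-dense B omits {}, as \<open>closedin_chi_preimage_pc\<close> requires.\<close>

lemma pc_closure_empty_imp_dense:
  assumes "{} \<in> pc_top closure_of B" shows "pc_top closure_of B = Pow places"
proof
  show "pc_top closure_of B \<subseteq> Pow places"
    using closure_of_subset_topspace[of pc_top B] by (simp add: topspace_pc_top)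
  show "Pow places \<subseteq> pc_top closure_of B"
  proof
    fix T assume T: "T \<in> Pow places"
    have "\<exists>y. y \<in> B \<and> y \<in> W" if "T \<in> W \<and> openin pc_top W" for W
    proof -
      have "{} \<in> W" using openin_pc_down_closed[of W T "{}"] that by blast
      then show ?thesis using assms that unfolding in_closure_of by blast
    qed
    then show "T \<in> pc_top closure_of B" using T unfolding in_closure_of topspace_pc_top by blast
  qed
qed

lemma pc_closureD:
  assumes "T \<in> pc_top closure_of B" "finite G" "G \<subseteq> places" "T \<inter> G = {}"
  obtains T' where "T' \<in> B" "T' \<subseteq> places" "T' \<inter> G = {}"
proof -
  have "T \<in> {T \<in> Pow places. T \<inter> G = {}}"
    using assms(1,4) by (simp add: in_closure_of topspace_pc_top)
  moreover have "\<forall>W. T \<in> W \<and> openin pc_top W \<longrightarrow> (\<exists>T'. T' \<in> B \<and> T' \<in> W)"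
    using assms(1) unfolding in_closure_of by (rule conjunct2)
  ultimately have "\<exists>T'. T' \<in> B \<and> T' \<in> {T \<in> Pow places. T \<inter> G = {}}"
    using openin_pc_basic[OF assms(2,3)] by (elim allE impE) (rule conjI)
  then show ?thesis using that by blast
qed

text \<open>A basic open set excludes finitely many places, and not vanishing at a given place is an
  open condition on adeles.\<close>

lemma continuous_map_zero_places: "continuous_map adele_top pc_top zero_places"
  unfolding pc_top_def
proof (rule continuous_on_generated_topo)
  fix W assume "W \<in> {{T \<in> Pow places. T \<inter> G = {}} | G. finite G \<and> G \<subseteq> places}"
  then obtain G where G: "finite G" "G \<subseteq> places" "W = {T \<in> Pow places. T \<inter> G = {}}" by blast
  have "openin adele_top {a \<in> adeles. v \<notin> zero_places a}" if "v \<in> places" for v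
  proof (cases v)
    case None
    have "openin adele_top {a \<in> topspace adele_top. snd a \<in> - {0}}"
      by (rule openin_continuous_map_preimage[OF continuous_map_adele_real]) (simp add: open_Compl)
    then show ?thesis by (simp add: None None_in_zero_places topspace_adele_top)
  next
    case (Some p)
    then have p: "p \<in> primes_set" using that by (auto simp: places_def)
    have "openin adele_top {a \<in> topspace adele_top. fst a p \<in> {x \<in> Qp p. x \<noteq> padic_zero}}"
      by (rule openin_continuous_map_preimage[OF continuous_map_adele_component[OF p] openin_Qp_nonzero])
    moreover have "{a \<in> topspace adele_top. fst a p \<in> {x \<in> Qp p. x \<noteq> padic_zero}} = {a \<in> adeles. v \<notin> zero_places a}"
      using p Af_Qp by (auto simp: Some Some_in_zero_places topspace_adele_top adeles_def)
    ultimately show ?thesis by simp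
  qed
  then have "openin adele_top (adeles \<inter> \<Inter> ((\<lambda>v. {a \<in> adeles. v \<notin> zero_places a}) ` G))"
    using G(1,2) openin_topspace[of adele_top] by (intro openin_Int_Inter) (auto simp: topspace_adele_top)
  moreover have "zero_places -` W \<inter> topspace adele_top = adeles \<inter> \<Inter> ((\<lambda>v. {a \<in> adeles. v \<notin> zero_places a}) ` G)"
    using zero_places_subset by (auto simp: G(3) topspace_adele_top)
  ultimately show "openin adele_top (zero_places -` W \<inter> topspace adele_top)" by simp
next
  have eq: "\<Union> {{T \<in> Pow places. T \<inter> G = {}} | G. finite G \<and> G \<subseteq> places} = Pow places"
    using topspace_pc_top unfolding pc_top_def topology_generated_by_topspace .
  show "zero_places ` topspace adele_top \<subseteq> \<Union> {{T \<in> Pow places. T \<inter> G = {}} | G. finite G \<and> G \<subseteq> places}"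
    unfolding eq using zero_places_subset by blast
qed

text \<open>With {} outside K, no invertible adele has its zero set in K, so the preimage is that of
  K under the continuous \<open>zero_places\<close>.\<close>

lemma closedin_chi_preimage_pc:
  assumes K: "closedin pc_top K" and "{} \<notin> K"
  shows "closedin adele_top {a \<in> adeles. chi a \<in> Inl ` K}"
proof -
  have "chi a \<in> Inl ` K \<longleftrightarrow> zero_places a \<in> K" for a
    using assms(2) zero_places_invertible[of a] chi_invertible[of a] chi_not_invertible[of a]
    by (cases "adele_invertible a") auto
  then show ?thesis
    using closedin_continuous_map_preimage[OF continuous_map_zero_places K] by (simp add: topspace_adele_top)
qed

section \<open>Closures in the quotient topology\<close>

context
  fixes \<tau> :: "(nat option set + adele) topology"
  assumes quot: "quotient_map adele_top \<tau> chi"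
begin

lemma topspace_quotient: "topspace \<tau> = chi_target"
  using quot chi_image_adeles by (simp add: quotient_map_def topspace_adele_top)

lemma closedin_quotientI:
  assumes "F \<subseteq> chi_target" "closedin adele_top {a \<in> adeles. chi a \<in> F}"
  shows "closedin \<tau> F"
  using quot assms unfolding quotient_map_closedin topspace_quotient topspace_adele_top by blast

text \<open>Approximating a single representative a is enough, since neighbourhoods of its image
  pull back to neighbourhoods of a.\<close>

lemma in_quotient_closureI:
  assumes a: "a \<in> adeles" and near: "\<And>W. openin adele_top W \<Longrightarrow> a \<in> W \<Longrightarrow> \<exists>b\<in>W. chi b \<in> F"
  shows "chi a \<in> \<tau> closure_of F"
  unfolding in_closure_of
proof (intro conjI allI impI)
  show "chi a \<in> topspace \<tau>" using a by (simp add: topspace_quotient flip: chi_image_adeles)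
  fix V assume V: "chi a \<in> V \<and> openin \<tau> V"
  have "openin adele_top {b \<in> topspace adele_top. chi b \<in> V}"
    by (rule openin_continuous_map_preimage[OF quotient_imp_continuous_map[OF quot]]) (use V in blast)
  from near[OF this] V a show "\<exists>y. y \<in> F \<and> y \<in> V" by (auto simp: topspace_adele_top)
qed

lemma chi_target_adele:
  assumes "x \<in> chi_target" obtains a where "a \<in> adeles" "x = chi a"
  using assms chi_image_adeles by blast

lemma chi_Inl_zero_places: "chi a = Inl T \<Longrightarrow> zero_places a = T"
  using chi_invertible[of a] chi_not_invertible[of a] by (cases "adele_invertible a") auto

text \<open>Near a representative of T all zero sets avoiding some finite G disjoint from T are
  realized; they form a power-cofinite neighbourhood of T, so one of them is in B.\<close>

lemma Inl_closure_subset: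
  "Inl ` (pc_top closure_of B) \<subseteq> \<tau> closure_of (Inl ` B)"
proof
  fix x :: "nat option set + adele" assume "x \<in> Inl ` (pc_top closure_of B)"
  then obtain T where T: "T \<in> pc_top closure_of B" "x = Inl T" by blast
  then have "x \<in> chi_target" by (simp add: in_closure_of topspace_pc_top chi_target_def)
  then obtain a where a: "a \<in> adeles" "x = chi a" by (rule chi_target_adele)
  then have zT: "zero_places a = T" using T(2) chi_Inl_zero_places by metis
  show "x \<in> \<tau> closure_of (Inl ` B)"
    unfolding a(2)
  proof (rule in_quotient_closureI[OF a(1)])
    fix W assume W: "openin adele_top W" "a \<in> W"
    obtain G where G: "finite G" "G \<subseteq> places" "zero_places a \<inter> G = {}"
      "\<And>T. T \<subseteq> places \<Longrightarrow> T \<inter> G = {} \<Longrightarrow> \<exists>b\<in>W. chi b = Inl T"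
      using ex_chi_Inl_nearby[OF W] by metis
    obtain T' where "T' \<in> B" "T' \<subseteq> places" "T' \<inter> G = {}"
      using pc_closureD[OF T(1) G(1,2)] G(3) zT by blast
    then show "\<exists>b\<in>W. chi b \<in> Inl ` B" using G(4)[of T'] by auto
  qed
qed

text \<open>The empty set avoids every G, so adeles with image \<open>Inl {}\<close> occur
  arbitrarily near any adele.\<close>

lemma closure_Inl_empty: "\<tau> closure_of {Inl {}} = chi_target"
proof
  show "\<tau> closure_of {Inl {}} \<subseteq> chi_target"
    using closure_of_subset_topspace[of \<tau>] by (simp add: topspace_quotient)
  show "chi_target \<subseteq> \<tau> closure_of {Inl {}}"
  proof
    fix x assume "x \<in> chi_target"
    then obtain a where a: "a \<in> adeles" "x = chi a" by (rule chi_target_adele)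
    show "x \<in> \<tau> closure_of {Inl {}}"
      unfolding a(2)
    proof (rule in_quotient_closureI[OF a(1)])
      fix W assume W: "openin adele_top W" "a \<in> W"
      obtain G where "\<And>T. T \<subseteq> places \<Longrightarrow> T \<inter> G = {} \<Longrightarrow> \<exists>b\<in>W. chi b = Inl T"
        using ex_chi_Inl_nearby[OF W] by metis
      from this[of "{}"] show "\<exists>b\<in>W. chi b \<in> {Inl {}}" by auto
    qed
  qed
qed

lemma closure_eq_target:
  assumes "Inl {} \<in> \<tau> closure_of F" shows "\<tau> closure_of F = chi_target"
proof
  show "\<tau> closure_of F \<subseteq> chi_target"
    using closure_of_subset_topspace[of \<tau>] by (simp add: topspace_quotient)
  show "chi_target \<subseteq> \<tau> closure_of F"
    unfolding closure_Inl_empty[symmetric] using assms by (intro closure_of_minimal closedin_closure_of) simp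
qed

lemma closure_Inl_not_dense:
  assumes B: "B \<subseteq> Pow places" and nd: "pc_top closure_of B \<noteq> Pow places"
  shows "\<tau> closure_of (Inl ` B) = Inl ` (pc_top closure_of B)"
proof
  have "{} \<notin> pc_top closure_of B" using nd pc_closure_empty_imp_dense by blast
  then have "closedin adele_top {a \<in> adeles. chi a \<in> Inl ` (pc_top closure_of B)}"
    by (intro closedin_chi_preimage_pc closedin_closure_of)
  moreover have "Inl ` (pc_top closure_of B) \<subseteq> chi_target"
    using closure_of_subset_topspace[of pc_top B] by (auto simp: chi_target_def topspace_pc_top)
  ultimately have "closedin \<tau> (Inl ` (pc_top closure_of B))" by (intro closedin_quotientI)
  then show "\<tau> closure_of (Inl ` B) \<subseteq> Inl ` (pc_top closure_of B)"
    using B by (intro closure_of_minimal image_mono closure_of_subset) (simp_all add: topspace_pc_top)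
qed (rule Inl_closure_subset)

lemma closure_Inl_dense:
  assumes "pc_top closure_of B = Pow places"
  shows "\<tau> closure_of (Inl ` B) = chi_target"
  using Inl_closure_subset[of B] assms by (intro closure_eq_target) auto

lemma closure_Inr_bounded:
  assumes C: "C \<subseteq> units_U" and \<epsilon>: "\<epsilon> > 0" "\<forall>c\<in>C. \<epsilon> \<le> snd c"
  shows "\<tau> closure_of (Inr ` C) = Inr ` (units_top closure_of C)"
proof
  let ?D = "units_top closure_of C"
  have DU: "?D \<subseteq> units_U"
    using closure_of_subset_topspace[of units_top C] by (simp add: topspace_units_top)
  \<comment> \<open>The lower bound on real components passes to the closure of C.\<close>
  have "continuous_map units_top euclideanreal snd"
    using continuous_map_compose[OF continuous_map_units_adele continuous_map_adele_real] by simp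
  then have "closedin units_top {c \<in> topspace units_top. snd c \<in> {\<epsilon>..}}"
    by (rule closedin_continuous_map_preimage) simp
  then have "?D \<subseteq> {c \<in> topspace units_top. snd c \<in> {\<epsilon>..}}"
    using C \<epsilon>(2) by (intro closure_of_minimal) (auto simp: topspace_units_top)
  then have ge: "\<epsilon> \<le> snd c" if "c \<in> ?D" for c using that by blast
  have "closedin adele_top ?D" by (rule closedin_adele_units[OF closedin_closure_of \<epsilon>(1) ge])
  then have "closedin adele_top {a \<in> adeles. chi a \<in> Inr ` ?D}"
    by (rule closedin_chi_preimage_units[OF _ DU \<epsilon>(1) ge])
  moreover have "Inr ` ?D \<subseteq> chi_target" using DU by (auto simp: chi_target_def)
  ultimately have "closedin \<tau> (Inr ` ?D)" by (intro closedin_quotientI)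
  then show "\<tau> closure_of (Inr ` C) \<subseteq> Inr ` ?D"
    using C by (intro closure_of_minimal image_mono closure_of_subset) (simp_all add: topspace_units_top)
  show "Inr ` ?D \<subseteq> \<tau> closure_of (Inr ` C)"
  proof
    fix x :: "nat option set + adele" assume "x \<in> Inr ` ?D"
    then obtain c where c: "c \<in> ?D" "x = Inr c" by blast
    then have cU: "c \<in> units_U" using DU by blast
    \<comment> \<open>A unit represents its own class, so adelic neighbourhoods of c can be
      restricted to the units.\<close>
    then have xc: "x = chi c" using c(2) chi_units by simp
    show "x \<in> \<tau> closure_of (Inr ` C)"
      unfolding xc
    proof (rule in_quotient_closureI)
      show "c \<in> adeles" using cU units_U_subset_adeles by blast
      fix W assume W: "openin adele_top W" "c \<in> W"
      have "openin units_top {b \<in> topspace units_top. id b \<in> W}"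
        by (rule openin_continuous_map_preimage[OF continuous_map_units_adele W(1)])
      moreover have "c \<in> {b \<in> topspace units_top. id b \<in> W}"
        using W(2) cU by (simp add: topspace_units_top)
      moreover have "\<forall>V. c \<in> V \<and> openin units_top V \<longrightarrow> (\<exists>c'. c' \<in> C \<and> c' \<in> V)"
        using c(1) unfolding in_closure_of by (rule conjunct2)
      ultimately have "\<exists>c'. c' \<in> C \<and> c' \<in> {b \<in> topspace units_top. id b \<in> W}"
        by (elim allE impE) (rule conjI)
      then obtain c' where "c' \<in> C" "c' \<in> W" by auto
      moreover from this have "chi c' = Inr c'" using C chi_units by blast
      ultimately show "\<exists>b\<in>W. chi b \<in> Inr ` C" by (intro bexI[of _ c']) simp_all
    qed
  qed
qed

lemma closure_Inr_unbounded:
  assumes C: "C \<subseteq> units_U" and 0: "0 \<in> closure (snd ` C)"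
  shows "\<tau> closure_of (Inr ` C) = chi_target"
proof (rule closure_eq_target)
  \<comment> \<open>Each finite component is p, a nonzero integral nonunit, so a vanishes nowhere
    without being invertible; integrality and the real component 1 fit
    \<open>ex_multiple_nearby\<close>.\<close>
  define a :: adele where "a = ((\<lambda>p\<in>primes_set. padic_pow 1), 1)"
  have aZ: "fst a p \<in> Zp p" if "p \<in> primes_set" for p
    using that padic_pow_Zp by (simp add: a_def primes_set_def)
  have "{p \<in> primes_set. fst a p \<notin> Zp p} = {}" using aZ by blast
  then have "finite {p \<in> primes_set. fst a p \<notin> Zp p}" by (simp only: finite.emptyI)
  moreover have "fst a \<in> (\<Pi>\<^sub>E p\<in>primes_set. Qp p)"
    using padic_pow_Qp by (simp add: a_def primes_set_def)
  ultimately have "fst a \<in> Af" unfolding Af_def by blast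
  then have a: "a \<in> adeles" by (simp add: adeles_def mem_Times_iff)
  have "\<not> adele_invertible a"
    by (rule not_invertible_infinite_nonunits[of "{}"]) (simp_all add: a_def Zp_units_def padic_pow_def)
  moreover have "zero_places a = {}"
    using padic_pow_nonzero unfolding zero_places_def a_def places_def by (auto split: option.splits)
  ultimately have chi_a: "chi a = Inl {}" by (simp add: chi_not_invertible)
  have "chi a \<in> \<tau> closure_of (Inr ` C)"
  proof (rule in_quotient_closureI[OF a])
    fix W assume W: "openin adele_top W" "a \<in> W"
    have "snd a = 1" by (simp add: a_def)
    then obtain c r where cr: "c \<in> C" "r \<noteq> 0" "adele_scale r c \<in> W"
      using ex_multiple_nearby[OF C 0 aZ _ W] by blast
    then have "chi (adele_scale r c) = Inr c" using C by (intro chi_adele_scale) auto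
    then show "\<exists>b\<in>W. chi b \<in> Inr ` C" using cr by auto
  qed
  then show "Inl {} \<in> \<tau> closure_of (Inr ` C)" unfolding chi_a .
qed

end

theorem theorem3p7:
  fixes \<tau> :: "(nat option set + adele) topology"
  assumes "quotient_map adele_top \<tau> chi"
  shows "(\<forall>B. B \<subseteq> Pow places \<longrightarrow>
            (pc_top closure_of B \<noteq> Pow places \<longrightarrow>
               \<tau> closure_of (Inl ` B) = Inl ` (pc_top closure_of B)) \<and>
            (pc_top closure_of B = Pow places \<longrightarrow>
               \<tau> closure_of (Inl ` B) = chi_target))
       \<and> (\<forall>C. C \<subseteq> units_U \<longrightarrow>
            ((\<exists>\<epsilon>>0. \<forall>c\<in>C. \<epsilon> \<le> snd c) \<longrightarrow>
               \<tau> closure_of (Inr ` C) = Inr ` (units_top closure_of C)) \<and>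
            (0 \<in> closure (snd ` C) \<longrightarrow>
               \<tau> closure_of (Inr ` C) = chi_target))"
proof (intro conjI allI impI)
  fix B assume "B \<subseteq> Pow places" "pc_top closure_of B \<noteq> Pow places"
  then show "\<tau> closure_of (Inl ` B) = Inl ` (pc_top closure_of B)" by (rule closure_Inl_not_dense[OF assms])
next
  fix B assume "pc_top closure_of B = Pow places"
  then show "\<tau> closure_of (Inl ` B) = chi_target" by (rule closure_Inl_dense[OF assms])
next
  fix C assume C: "C \<subseteq> units_U" and "\<exists>\<epsilon>>0. \<forall>c\<in>C. \<epsilon> \<le> snd c"
  then obtain \<epsilon> where "\<epsilon> > 0" "\<forall>c\<in>C. \<epsilon> \<le> snd c" by blast
  then show "\<tau> closure_of (Inr ` C) = Inr ` (units_top closure_of C)" by (rule closure_Inr_bounded[OF assms C])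
next
  fix C assume "C \<subseteq> units_U" "0 \<in> closure (snd ` C)"
  then show "\<tau> closure_of (Inr ` C) = chi_target" by (rule closure_Inr_unbounded[OF assms])
qed

end
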